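(* Let $f:\mathbb C\to\mathbb C$ be a transcendental entire function, let $\delta\in\mathbb C\setminus\{0\}$, and let $F:\mathbb C^2\to\mathbb C^2$, $F(z,w)=(f(z)-\delta w,z)$. Then $h_{\mathrm{top}}(\mathbb C^2,F)=+\infty$.
   Context: A transcendental Hénon map is a map $F(z,w)=(f(z)-\delta w,z)$ with $f$ transcendental entire (entire, not a polynomial) and $\delta\neq 0$; it is a holomorphic automorphism of $\mathbb C^2$. Topological entropy on a compact space: if $X$ is a compact metric space and $g:X\to X$ is continuous, a set $E\subset X$ is $(n,\varepsilon)$-separated if for any $z\neq w\in E$ there is $0\le k\le n-1$ with $d(g^k(z),g^k(w))>\varepsilon$; with $K(n,\varepsilon)$ the maximal cardinality of an $(n,\varepsilon)$-separated set, $h_{\mathrm{top}}(X,g)=\sup_{\varepsilon>0}\limsup_{n\to\infty}\frac1n\log K(n,\varepsilon)$. For a continuous self-map $g$ of a (possibly non-compact) metric space $Y$, $h_{\mathrm{top}}(Y,g)$ is defined as the supremum of $h_{\mathrm{top}}(X,g|_X)$ over all compact subsets $X\subset Y$ with $g(X)\subset X$, and as $0$ if there is no such set. *)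

theory Defs
  imports "HOL-Analysis.Analysis" "HOL-Computational_Algebra.Polynomial"
begin

definition transcendental_entire :: "(complex \<Rightarrow> complex) \<Rightarrow> bool" where
  "transcendental_entire f \<longleftrightarrow> f holomorphic_on UNIV \<and> \<not> (\<exists>p. \<forall>z. f z = poly p z)"

definition henon_map :: "(complex \<Rightarrow> complex) \<Rightarrow> complex \<Rightarrow> complex \<times> complex \<Rightarrow> complex \<times> complex" where
  "henon_map f \<delta> = (\<lambda>(z, w). (f z - \<delta> * w, z))"

definition separated_set :: "('a::metric_space \<Rightarrow> 'a) \<Rightarrow> nat \<Rightarrow> real \<Rightarrow> 'a set \<Rightarrow> bool" where
  "separated_set g n \<epsilon> E \<longleftrightarrow>
     (\<forall>z\<in>E. \<forall>w\<in>E. z \<noteq> w \<longrightarrow> (\<exists>k<n. dist ((g ^^ k) z) ((g ^^ k) w) > \<epsilon>))"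

text \<open>Maximal cardinality K(n,eps) of an (n,eps)-separated subset of X (as an extended real;
  supremum over finite separated subsets, which equals the maximal cardinality).\<close>
definition max_sep_card :: "'a::metric_space set \<Rightarrow> ('a \<Rightarrow> 'a) \<Rightarrow> nat \<Rightarrow> real \<Rightarrow> ereal" where
  "max_sep_card X g n \<epsilon> =
     Sup {ereal (real (card E)) | E. finite E \<and> E \<subseteq> X \<and> separated_set g n \<epsilon> E}"

definition eln :: "ereal \<Rightarrow> ereal" where
  "eln x = (if x = \<infinity> then \<infinity> else if x \<le> 0 then -\<infinity> else ereal (ln (real_of_ereal x)))"

definition htop_compact :: "'a::metric_space set \<Rightarrow> ('a \<Rightarrow> 'a) \<Rightarrow> ereal" where
  "htop_compact X g =
     (SUP \<epsilon>\<in>{0<..}. limsup (\<lambda>n. eln (max_sep_card X g n \<epsilon>) / ereal (real n)))"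

definition htop :: "'a::metric_space set \<Rightarrow> ('a \<Rightarrow> 'a) \<Rightarrow> ereal" where
  "htop Y g =
     (if \<exists>X. X \<subseteq> Y \<and> compact X \<and> g ` X \<subseteq> X
      then (SUP X\<in>{X. X \<subseteq> Y \<and> compact X \<and> g ` X \<subseteq> X}. htop_compact X g)
      else 0)"

end

theory Submission
  imports Defs "HOL-Complex_Analysis.Complex_Analysis"
begin

text \<open>Orbits of the Henon map correspond to sequences with \<open>x\<^bsub>k+2\<^esub> + \<delta> x\<^bsub>k\<^esub> = f x\<^bsub>k+1\<^esub>\<close>. For numbers
  \<open>\<Lambda>\<close> tending to infinity, the functions \<open>f (\<Lambda> z) / \<Lambda>\<close> fail to be normal at \<open>0\<close> and, for suitable
  \<open>\<Lambda>\<close>, at a point \<open>e \<noteq> 0\<close>. Zalcman's rescaling gives nonconstant entire limit functions at \<open>e\<close> and,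
  for every \<open>N\<close>, at \<open>2 N\<close> separate places that all tend to \<open>0\<close>: at the scale \<open>r\<close> where the maximum
  modulus of \<open>f\<close> reaches \<open>norm \<Lambda>\<close>, finitely many points of non-normality cannot separate the unit disc,
  where \<open>f (r z) / \<Lambda>\<close> is bounded, from larger circles, on which it is unbounded. By Picard's theorem each
  limit function omits at most one value, so near each of these places \<open>f\<close> maps a small disc over a disc
  of size comparable to \<open>\<Lambda>\<close> around \<open>\<Lambda> v\<close>, for all \<open>v\<close> but one. Depending on which of these limits omit
  \<open>0\<close>, one of the periodic patterns \<open>0\<close>, \<open>0 0 e\<close>, \<open>0 0 e e\<close> only requires values that are taken, and
  \<open>N\<close> free choices per period give entropy at least \<open>ln N / 4\<close>.\<close>

section \<open>Bounded spherical derivative\<close>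

text \<open>Up to a constant factor, the speed of \<open>g\<close> as a map into the Riemann sphere.
  By Marty's criterion a family is normal exactly where this quantity is locally bounded.\<close>

definition sph_deriv :: "(complex \<Rightarrow> complex) \<Rightarrow> complex \<Rightarrow> real" where
  "sph_deriv g z = norm (deriv g z) / (1 + (norm (g z))\<^sup>2)"

lemma sph_deriv_nonneg: "sph_deriv g z \<ge> 0"
  by (simp add: sph_deriv_def)

text \<open>Up to an affine change, \<open>1 / (1 + (norm (g w))\<^sup>2)\<close> is the height of
  \<open>g w\<close> on the Riemann sphere, and a height changes no faster than the point moves. In
  the estimate of the derivative this becomes \<open>2 * x \<le> 1 + x\<^sup>2\<close>.\<close>

lemma sph_deriv_Lipschitz:
  assumes hol: "g holomorphic_on ball z r"
    and C: "\<And>w. w \<in> ball z r \<Longrightarrow> sph_deriv g w \<le> C"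
    and w: "w \<in> ball z r"
  shows "\<bar>1 / (1 + (norm (g w))\<^sup>2) - 1 / (1 + (norm (g z))\<^sup>2)\<bar> \<le> C * norm (w - z)"
proof -
  let ?f = "\<lambda>u. 1 / (1 + g u \<bullet> g u)"
  let ?f' = "\<lambda>u h. - (2 * (g u \<bullet> (deriv g u * h))) / (1 + g u \<bullet> g u)\<^sup>2"
  have "norm (?f w - ?f z) \<le> C * norm (w - z)"
  proof (rule differentiable_bound[where S = "ball z r" and f' = ?f'])
    fix u assume u: "u \<in> ball z r"
    have "(g has_field_derivative deriv g u) (at u)"
      using hol u by (simp add: holomorphic_derivI)
    then have dg: "(g has_derivative (*) (deriv g u)) (at u within ball z r)"
      by (simp add: has_field_derivative_def has_derivative_at_withinI)
    have pos: "1 + g u \<bullet> g u > 0"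
      by (simp add: add_pos_nonneg)
    show "(?f has_derivative ?f' u) (at u within ball z r)"
      using pos
      by (auto intro!: derivative_eq_intros dg ext simp: inner_commute power2_eq_square field_simps)
    show "onorm (?f' u) \<le> C"
    proof (rule onorm_bound)
      show "0 \<le> C"
        using C[OF u] sph_deriv_nonneg[of g u] by linarith
      fix h
      define x where "x = norm (g u)"
      have x0: "x \<ge> 0" by (simp add: x_def)
      have D: "norm (deriv g u) \<le> C * (1 + x\<^sup>2)"
        using C[OF u] by (simp add: sph_deriv_def x_def divide_le_eq add_pos_nonneg)
      have "\<bar>2 * (g u \<bullet> (deriv g u * h))\<bar> \<le> 2 * x * (norm (deriv g u) * norm h)"
        using Cauchy_Schwarz_ineq2[of "g u" "deriv g u * h"] by (simp add: x_def norm_mult)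
      also have "\<dots> \<le> (1 + x\<^sup>2) * ((C * (1 + x\<^sup>2)) * norm h)"
      proof (rule mult_mono)
        show "2 * x \<le> 1 + x\<^sup>2"
          using sum_squares_ge_zero[of "x - 1" 0] by (simp add: power2_eq_square algebra_simps)
        show "norm (deriv g u) * norm h \<le> C * (1 + x\<^sup>2) * norm h"
          using D by (simp add: mult_right_mono)
      qed (use x0 in auto)
      finally have "\<bar>2 * (g u \<bullet> (deriv g u * h))\<bar> \<le> C * norm h * (1 + x\<^sup>2)\<^sup>2"
        by (simp add: power2_eq_square algebra_simps)
      moreover have "g u \<bullet> g u = x\<^sup>2"
        by (simp add: x_def power2_norm_eq_inner)
      moreover have "(1 + x\<^sup>2)\<^sup>2 > 0"
        by (intro zero_less_power) (simp add: add_pos_nonneg)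
      ultimately show "norm (?f' u h) \<le> C * norm h"
        by (simp add: abs_divide divide_le_eq)
    qed
  qed (use w in \<open>auto simp: dist_norm\<close>, metis dist_norm dist_self mem_ball norm_minus_commute w zero_le_dist order.strict_trans1)
  then show ?thesis
    by (simp add: power2_norm_eq_inner)
qed

text \<open>Within \<open>1 / (10 * C)\<close> the height changes by at most \<open>1 / 10\<close>,
  whereas modulus 2 has height \<open>1 / 5\<close>. Hence small values stay small, and large values
  stay away from 0, which is what Schottky's theorem needs.\<close>

lemma sph_deriv_near:
  assumes hol: "g holomorphic_on ball z r" and "C > 0"
    and C: "\<And>w. w \<in> ball z r \<Longrightarrow> sph_deriv g w \<le> C"
    and w: "w \<in> ball z (min r (1 / (10 * C)))"
  shows "norm (g z) \<le> 2 \<Longrightarrow> norm (g w) \<le> 3" "norm (g z) \<ge> 2 \<Longrightarrow> norm (g w) \<ge> 1"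
proof -
  have "C * norm (w - z) \<le> 1 / 10"
    using w \<open>C > 0\<close> by (simp add: dist_norm norm_minus_commute field_simps)
  then have L: "\<bar>1 / (1 + (norm (g w))\<^sup>2) - 1 / (1 + (norm (g z))\<^sup>2)\<bar> \<le> 1 / 10"
    using sph_deriv_Lipschitz[OF hol C, of w] w by auto
  {
    assume "norm (g z) \<le> 2"
    then have "(norm (g z))\<^sup>2 \<le> 2\<^sup>2"
      by (intro power_mono) auto
    then have "1 / (1 + (norm (g z))\<^sup>2) \<ge> 1 / 5"
      by (intro divide_left_mono) (auto simp: add_pos_nonneg)
    then have "1 / (1 + (norm (g w))\<^sup>2) \<ge> 1 / 10"
      using L by linarith
    then have "(norm (g w))\<^sup>2 \<le> 3\<^sup>2"
      by (simp add: le_divide_eq add_pos_nonneg)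
    then show "norm (g w) \<le> 3"
      by (rule power2_le_imp_le) auto
  }
  {
    assume "norm (g z) \<ge> 2"
    then have "(norm (g z))\<^sup>2 \<ge> 2\<^sup>2"
      by (intro power_mono) auto
    then have "1 / (1 + (norm (g z))\<^sup>2) \<le> 1 / 5"
      by (intro divide_left_mono) (auto simp: add_pos_nonneg)
    then have "1 / (1 + (norm (g w))\<^sup>2) \<le> 1 / 2"
      using L by linarith
    then have "(norm (g w))\<^sup>2 \<ge> 1\<^sup>2"
      by (simp add: divide_le_eq add_pos_nonneg)
    then show "norm (g w) \<ge> 1"
      by (rule power2_le_imp_le) auto
  }
qed

text \<open>The entry 3 serves centres with value of modulus at most 2. The other entry is
  Schottky's bound at radius \<open>1 / 2\<close> for a function of modulus at most
  \<open>2 * B\<close> at 0.\<close>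

definition growth_bound :: "real \<Rightarrow> real" where
  "growth_bound B = max 3 (exp (pi * exp (pi * (2 + 2 * (2 * B) + 12))))"

text \<open>Either \<open>g\<close> is small at the centre and stays small, or it keeps modulus at
  least 1 nearby; in the latter case \<open>2 * g\<close> omits 0 and 1, and Schottky's theorem
  bounds it by its value at the centre.\<close>

lemma sph_deriv_growth:
  assumes hol: "g holomorphic_on ball z r" and "C > 0"
    and C: "\<And>w. w \<in> ball z r \<Longrightarrow> sph_deriv g w \<le> C"
    and w: "w \<in> ball z (min r (1 / (10 * C)) / 4)" and B: "norm (g z) \<le> B"
  shows "norm (g w) \<le> growth_bound B"
proof -
  define c where "c = min r (1 / (10 * C))"
  have wc: "w \<in> ball z (c / 4)"
    using w by (simp add: c_def)
  then have c: "c > 0"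
    by (metis ball_eq_empty empty_iff linorder_not_less zero_less_divide_iff zero_less_numeral not_less_iff_gr_or_eq)
  show ?thesis
  proof (cases "norm (g z) \<le> 2")
    case True
    have "w \<in> ball z (min r (1 / (10 * C)))"
      using wc c unfolding c_def[symmetric] by auto
    then show ?thesis
      using sph_deriv_near(1)[OF hol \<open>C > 0\<close> C \<open>w \<in> ball z (min r (1 / (10 * C)))\<close> True] unfolding growth_bound_def
      by (intro max.coboundedI1) (auto simp: c_def)
  next
    case False
    \<comment> \<open>The factor 2 raises the lower bound 1 for the modulus to 2, so that the value
      1 is omitted as well as 0. The radius \<open>c / 2\<close> keeps the closed disc inside the
      ball where that bound holds.\<close>
    define h where "h = (\<lambda>\<zeta>. 2 * g (z + of_real (c / 2) * \<zeta>))"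
    have sub: "z + of_real (c / 2) * \<zeta> \<in> ball z c" if "\<zeta> \<in> cball 0 1" for \<zeta>
    proof -
      have "norm \<zeta> * (c / 2) \<le> 1 * (c / 2)"
        using that c by (intro mult_right_mono) auto
      then show ?thesis
        using c by (simp add: dist_norm norm_mult norm_divide)
    qed
    define \<zeta> where "\<zeta> = (w - z) / of_real (c / 2)"
    have "norm (h \<zeta>) \<le> exp (pi * exp (pi * (2 + 2 * (2 * B) + 12 * (1/2) / (1 - 1/2))))"
    proof (rule Schottky[where f = h])
      have "g holomorphic_on ball z c"
        using hol by (rule holomorphic_on_subset) (auto simp: c_def)
      then have "(g \<circ> (\<lambda>\<zeta>. z + of_real (c / 2) * \<zeta>)) holomorphic_on cball 0 1"
        using sub by (intro holomorphic_on_compose_gen[where t = "ball z c"] holomorphic_intros) blast+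
      then show "h holomorphic_on cball 0 1"
        unfolding h_def o_def by (intro holomorphic_intros)
      show "norm (h 0) \<le> 2 * B"
        using B by (simp add: h_def norm_mult)
      show "\<not> (h x = 0 \<or> h x = 1)" if "x \<in> cball 0 1" for x
      proof -
        have "norm (g (z + of_real (c / 2) * x)) \<ge> 1"
          using sph_deriv_near(2)[OF hol \<open>C > 0\<close> C sub[OF that, unfolded c_def]] False by (auto simp: c_def)
        then have "norm (h x) \<ge> 2"
          by (simp add: h_def norm_mult)
        then show ?thesis by auto
      qed
      have "norm (w - z) \<le> c / 4"
        using wc by (simp add: dist_norm norm_minus_commute)
      then show "norm \<zeta> \<le> 1 / 2"
        unfolding \<zeta>_def norm_divide norm_of_real using c by (simp add: divide_le_eq)
    qed auto
    moreover have "of_real (c / 2) * \<zeta> = w - z"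
      unfolding \<zeta>_def using c by (subst times_divide_eq_right, subst nonzero_mult_div_cancel_left) auto
    then have "h \<zeta> = 2 * g (z + (w - z))"
      unfolding h_def by (simp only:)
    then have "norm (h \<zeta>) = 2 * norm (g w)"
      by (simp add: norm_mult)
    ultimately have "2 * norm (g w) \<le> exp (pi * exp (pi * (2 + 2 * (2 * B) + 12)))"
      by simp
    then show ?thesis
      unfolding growth_bound_def using norm_ge_zero[of "g w"] by linarith
  qed
qed

text \<open>If \<open>norm (g z)\<close> were huge, \<open>g\<close> would be large on a whole disc.
  Cauchy's estimate would then bound the derivative of \<open>1 / g\<close> at \<open>z\<close> by
  \<open>1 / 2\<close>, while \<open>sph_deriv g z \<ge> 1\<close> makes it at least 1.\<close>

lemma norm_bound_of_sph_deriv: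
  assumes hol: "g holomorphic_on ball z r" and "C > 0" "r > 0"
    and C: "\<And>w. w \<in> ball z r \<Longrightarrow> sph_deriv g w \<le> C"
    and 1: "sph_deriv g z \<ge> 1"
  defines "c \<equiv> min (r / 2) (1 / (10 * C)) / 4"
  shows "norm (g z) \<le> max 2 (growth_bound (4 / c))"
proof (rule ccontr)
  assume neg: "\<not> ?thesis"
  have c: "c > 0" using assms by (simp add: c_def)
  have cr: "c \<le> r / 8" "c \<le> 1 / (10 * C)" "c * 4 \<le> 1 / (10 * C)"
    unfolding c_def using \<open>C > 0\<close> by (auto simp: min_def field_simps)
  \<comment> \<open>Growth is applied with the roles exchanged: a moderate value at \<open>w\<close>
    would bound the value at \<open>z\<close>. The radius \<open>r / 2\<close> keeps the disc around
    \<open>w\<close> inside \<open>ball z r\<close>.\<close>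
  have big: "norm (g w) \<ge> 4 / c" if w: "w \<in> ball z c" for w
  proof (rule ccontr)
    assume "\<not> norm (g w) \<ge> 4 / c"
    moreover have sub: "ball w (r / 2) \<subseteq> ball z r"
      using w cr by (intro ball_subset_ball_iff[THEN iffD2]) (auto simp: dist_commute)
    ultimately have "norm (g z) \<le> growth_bound (4 / c)"
      using w by (intro sph_deriv_growth[OF holomorphic_on_subset[OF hol sub] \<open>C > 0\<close> C[OF subsetD[OF sub]]])
        (simp_all add: c_def dist_commute)
    then show False using neg by simp
  qed
  define k where "k = (\<lambda>w. inverse (g w))"
  have sub: "ball z c \<subseteq> ball z r" using cr c by auto
  have nz: "g w \<noteq> 0" if "w \<in> ball z c" for w
    using big[OF that] c by (metis divide_pos_pos norm_zero not_less zero_less_numeral)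
  have "norm ((deriv ^^ 1) k z) \<le> fact 1 * (c / 4) / (c / 2) ^ 1"
  proof (rule Cauchy_inequality)
    have k: "k holomorphic_on ball z c"
      unfolding k_def by (intro holomorphic_intros holomorphic_on_subset[OF hol sub] nz)
    then show "k holomorphic_on ball z (c / 2)"
      by (rule holomorphic_on_subset) (use c in auto)
    show "continuous_on (cball z (c / 2)) k"
      using k by (intro holomorphic_on_imp_continuous_on holomorphic_on_subset[OF k]) (use c in auto)
    show "norm (k x) \<le> c / 4" if "norm (z - x) = c / 2" for x
    proof -
      have "norm (g x) \<ge> 4 / c"
        using that c by (intro big) (simp add: dist_norm)
      then have "inverse (norm (g x)) \<le> inverse (4 / c)"
        using c by (intro le_imp_inverse_le) auto
      then show ?thesis by (simp add: k_def norm_inverse)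
    qed
  qed (use c in auto)
  then have k1: "norm (deriv k z) \<le> 1 / 2"
    using c by simp
  have z: "z \<in> ball z r" using \<open>r > 0\<close> by simp
  have zc: "z \<in> ball z c" using c by simp
  have dg: "(g has_field_derivative deriv g z) (at z)"
    using hol z by (simp add: holomorphic_derivI)
  have "(k has_field_derivative - (deriv g z / (g z)\<^sup>2)) (at z)"
    unfolding k_def using nz[OF zc] by (auto intro!: derivative_eq_intros dg simp: field_simps power2_eq_square)
  then have "deriv k z = - (deriv g z / (g z)\<^sup>2)"
    by (rule DERIV_imp_deriv)
  then have "norm (deriv k z) = norm (deriv g z) / (norm (g z))\<^sup>2"
    by (simp add: norm_divide norm_power)
  moreover have "norm (deriv g z) \<ge> 1 + (norm (g z))\<^sup>2"
    using 1 by (simp add: sph_deriv_def le_divide_eq add_pos_nonneg)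
  moreover have "(norm (g z))\<^sup>2 > 0"
    using nz[OF zc] by simp
  ultimately have "norm (deriv k z) \<ge> 1"
    by (simp add: le_divide_eq)
  then show False using k1 by simp
qed

text \<open>The points where the sequence is bounded form an open and closed subset of \<open>K\<close>.\<close>
lemma sph_deriv_bounded_imp_bounded:
  fixes g :: "nat \<Rightarrow> complex \<Rightarrow> complex"
  assumes hol: "\<And>n. g n holomorphic_on UNIV" and K: "compact K" "connected K" and "\<eta> > 0"
    and C: "\<And>n z w. z \<in> K \<Longrightarrow> w \<in> ball z \<eta> \<Longrightarrow> sph_deriv (g n) w \<le> C"
    and p: "p \<in> K" "\<And>n. norm (g n p) \<le> M"
  shows "\<exists>B. \<forall>n. \<forall>z\<in>K. norm (g n z) \<le> B"
proof -
  define C' where "C' = max C 1"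
  define c where "c = min \<eta> (1 / (10 * C')) / 4"
  have c: "c > 0" using \<open>\<eta> > 0\<close> by (simp add: c_def C'_def)
  have step: "norm (g n w) \<le> growth_bound B" if "z \<in> K" "w \<in> ball z c" "norm (g n z) \<le> B" for n z w B
  proof (rule sph_deriv_growth[where r = \<eta> and C = C' and g = "g n" and z = z and w = w and B = B])
    show "sph_deriv (g n) w \<le> C'" if "w \<in> ball z \<eta>" for w
      using C[OF \<open>z \<in> K\<close> that, of n] by (simp add: C'_def)
    show "g n holomorphic_on ball z \<eta>"
      using hol by (rule holomorphic_on_subset) auto
    show "w \<in> ball z (min \<eta> (1 / (10 * C')) / 4)"
      using that(2) unfolding c_def .
  qed (use that in \<open>simp_all add: C'_def\<close>)
  define A where "A = {z \<in> K. \<exists>B. \<forall>n. norm (g n z) \<le> B}"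
  have AsubK: "A \<subseteq> K" by (auto simp: A_def)
  \<comment> \<open>The radius \<open>c\<close> depends neither on the point nor on the index, so
    boundedness passes to all points of \<open>K\<close> within \<open>c\<close>. This makes both
    \<open>A\<close> and its complement open in \<open>K\<close>.\<close>
  have near: "w \<in> A" if zw: "z \<in> A" "w \<in> K" "dist z w < c" for z w
  proof -
    obtain B where "z \<in> K" "\<And>n. norm (g n z) \<le> B" using zw(1) by (auto simp: A_def)
    then have "norm (g n w) \<le> growth_bound B" for n
      using zw(3) by (intro step) auto
    then show ?thesis using zw(2) by (auto simp: A_def)
  qed
  have "openin (top_of_set K) A"
    unfolding openin_euclidean_subtopology_iff
    using near c AsubK by (metis dist_commute)
  moreover have "closedin (top_of_set K) A"
  proof -
    have "openin (top_of_set K) (K - A)"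
      unfolding openin_euclidean_subtopology_iff using near c by (metis Diff_iff Diff_subset)
    then show ?thesis
      using AsubK by (simp add: closedin_def)
  qed
  moreover have "A \<noteq> {}" using p by (auto simp: A_def)
  ultimately have AK: "A = K"
    using K(2) unfolding connected_clopen by blast
  have "K \<subseteq> (\<Union>z\<in>K. ball z c)" using c by auto
  then obtain F where F: "F \<subseteq> K" "finite F" "K \<subseteq> (\<Union>z\<in>F. ball z c)"
    by (rule compactE_image[OF K(1), rotated]) auto
  have "\<forall>z\<in>F. \<exists>B. \<forall>n. norm (g n z) \<le> B"
    using F(1) AK by (auto simp: A_def)
  then obtain b where b: "\<And>z n. z \<in> F \<Longrightarrow> norm (g n z) \<le> b z"
    by metis
  have "norm (g n w) \<le> (\<Sum>z\<in>F. growth_bound (b z))" if "w \<in> K" for n w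
  proof -
    obtain z where z: "z \<in> F" "w \<in> ball z c" using F(3) \<open>w \<in> K\<close> by blast
    then have "norm (g n w) \<le> growth_bound (b z)"
      using step[of z w n "b z"] F(1) b[of z n] by auto
    also have "\<dots> \<le> (\<Sum>z\<in>F. growth_bound (b z))"
      using z(1) F(2) by (intro member_le_sum) (auto simp: growth_bound_def)
    finally show ?thesis .
  qed
  then show ?thesis by blast
qed

section \<open>Zalcman's rescaling\<close>

lemma sph_deriv_rescale:
  assumes "g holomorphic_on UNIV"
  shows "sph_deriv (\<lambda>\<zeta>. g (w + of_real \<tau> * \<zeta>)) \<zeta> = \<bar>\<tau>\<bar> * sph_deriv g (w + of_real \<tau> * \<zeta>)"
proof -
  have "(g has_field_derivative deriv g (w + of_real \<tau> * \<zeta>)) (at (w + of_real \<tau> * \<zeta>))"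
    using assms by (simp add: holomorphic_derivI)
  then have "((\<lambda>\<zeta>. g (w + of_real \<tau> * \<zeta>)) has_field_derivative
      deriv g (w + of_real \<tau> * \<zeta>) * of_real \<tau>) (at \<zeta>)"
    by (rule DERIV_chain2) (auto intro!: derivative_eq_intros)
  then have "deriv (\<lambda>\<zeta>. g (w + of_real \<tau> * \<zeta>)) \<zeta> = deriv g (w + of_real \<tau> * \<zeta>) * of_real \<tau>"
    by (rule DERIV_imp_deriv)
  then show ?thesis
    by (simp add: sph_deriv_def norm_mult)
qed

lemma continuous_on_sph_deriv:
  assumes "g holomorphic_on UNIV"
  shows "continuous_on A (sph_deriv g)"
proof -
  have "continuous_on UNIV g" "continuous_on UNIV (deriv g)"
    using assms by (auto intro: holomorphic_on_imp_continuous_on holomorphic_deriv)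
  then have "continuous_on A g" "continuous_on A (deriv g)"
    by (auto intro: continuous_on_subset)
  moreover have "1 + (norm (g z))\<^sup>2 \<noteq> 0" for z
    by (metis add_nonneg_eq_0_iff zero_le_one zero_le_power2 zero_neq_one)
  ultimately show ?thesis
    unfolding sph_deriv_def by (intro continuous_intros) auto
qed

lemma holomorphic_affine_comp:
  assumes "g holomorphic_on UNIV"
  shows "(\<lambda>\<zeta>. g (a + b * \<zeta>)) holomorphic_on A"
proof -
  have "(g \<circ> (\<lambda>\<zeta>. a + b * \<zeta>)) holomorphic_on A"
    by (rule holomorphic_on_compose_gen[OF _ assms]) (auto intro!: holomorphic_intros)
  then show ?thesis by (simp add: o_def)
qed

text \<open>Zalcman's choice: a maximum point of \<open>(r - |w - z0|) * sph_deriv g w\<close> on the disc of radius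
  \<open>r\<close> around \<open>z0\<close>.\<close>
lemma Zalcman_point:
  assumes hol: "g holomorphic_on UNIV" and s: "sph_deriv g z0 \<ge> s" "s > 0" and r: "r > 0"
  obtains w \<tau> where "norm (w - z0) \<le> r" "0 < \<tau>" "\<tau> \<le> 1 / s" "\<tau> * sph_deriv g w = 1"
    "\<And>\<zeta>. norm \<zeta> \<le> r * s / 2 \<Longrightarrow> \<tau> * sph_deriv g (w + of_real \<tau> * \<zeta>) \<le> 2"
proof -
  define h where "h = (\<lambda>w. (r - norm (w - z0)) * sph_deriv g w)"
  have "continuous_on (cball z0 r) h"
    unfolding h_def by (intro continuous_intros continuous_on_sph_deriv[OF hol])
  then obtain w where w: "w \<in> cball z0 r" "\<And>y. y \<in> cball z0 r \<Longrightarrow> h y \<le> h w"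
    using continuous_attains_sup[of "cball z0 r" h] r by auto
  define d where "d = r - norm (w - z0)"
  have wd: "norm (w - z0) \<le> r" using w(1) by (simp add: dist_norm norm_minus_commute)
  have "r * s \<le> h z0"
    using r s by (simp add: h_def)
  also have "\<dots> \<le> h w" using r by (intro w) auto
  finally have hw: "r * s \<le> d * sph_deriv g w" by (simp add: h_def d_def)
  moreover have "r * s > 0" using r s by simp
  ultimately have "d * sph_deriv g w > 0" by linarith
  moreover have "d \<ge> 0" using wd by (simp add: d_def)
  ultimately have d: "d > 0" and sw: "sph_deriv g w > 0"
    using sph_deriv_nonneg[of g w] by (auto simp: zero_less_mult_iff)
  \<comment> \<open>Rescaling by \<open>\<tau>\<close> normalizes the spherical derivative at the
    centre to 1.\<close>
  define \<tau> where "\<tau> = 1 / sph_deriv g w"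
  have \<tau>: "\<tau> > 0" "\<tau> * sph_deriv g w = 1" using sw by (auto simp: \<tau>_def)
  have "d \<le> r" by (simp add: d_def)
  then have "r * s \<le> r * sph_deriv g w"
    using hw sw by (meson mult_right_mono order_trans less_imp_le)
  then have "s \<le> sph_deriv g w" using r by simp
  then have "\<tau> \<le> 1 / s" using s by (simp add: \<tau>_def frac_le)
  moreover have "\<tau> * sph_deriv g (w + of_real \<tau> * \<zeta>) \<le> 2" if "norm \<zeta> \<le> r * s / 2" for \<zeta>
  proof -
    define u where "u = w + of_real \<tau> * \<zeta>"
    have "norm (u - w) = \<tau> * norm \<zeta>" using \<tau> by (simp add: u_def norm_mult)
    also have "\<dots> \<le> \<tau> * (d * sph_deriv g w / 2)"
      using that hw \<tau> by (intro mult_left_mono) auto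
    also have "\<dots> = d / 2 * (\<tau> * sph_deriv g w)" by simp
    also have "\<dots> = d / 2" using \<tau>(2) by simp
    finally have uw: "norm (u - w) \<le> d / 2" .
    have "norm (u - z0) \<le> norm (u - w) + norm (w - z0)"
      by (rule norm_diff_triangle_le) auto
    \<comment> \<open>Within \<open>d / 2\<close> of \<open>w\<close> the weight is at least half of
      its value at \<open>w\<close>, so by maximality the spherical derivative at most doubles
      there.\<close>
    then have du: "d / 2 \<le> r - norm (u - z0)" using uw by (simp add: d_def)
    then have "u \<in> cball z0 r" using d by (simp add: dist_norm norm_minus_commute)
    then have "h u \<le> h w" by (rule w)
    moreover have "d / 2 * sph_deriv g u \<le> h u"
      unfolding h_def using du by (intro mult_right_mono sph_deriv_nonneg)
    ultimately have "d / 2 * sph_deriv g u \<le> d * sph_deriv g w"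
      by (simp add: h_def d_def)
    then have "sph_deriv g u \<le> 2 * sph_deriv g w" using d by simp
    then have "\<tau> * sph_deriv g u \<le> \<tau> * (2 * sph_deriv g w)"
      using \<tau> by (intro mult_left_mono) auto
    also have "\<dots> = 2" using \<tau>(2) by simp
    finally show ?thesis by (simp add: u_def)
  qed
  ultimately show ?thesis using that wd \<tau> by blast
qed

text \<open>A witness, in the sense of Zalcman, that the sequence is not normal where the centres
  \<open>w n\<close> accumulate. The limit of the centres is not part of the notion and is stated
  separately.\<close>

definition rescaled_limit ::
  "(nat \<Rightarrow> complex \<Rightarrow> complex) \<Rightarrow> (nat \<Rightarrow> complex) \<Rightarrow> (nat \<Rightarrow> real) \<Rightarrow> (complex \<Rightarrow> complex) \<Rightarrow> bool" where
  "rescaled_limit g w \<tau> G \<longleftrightarrow> G holomorphic_on UNIV \<and> \<not> G constant_on UNIV \<and>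
     (\<forall>n. \<tau> n > 0) \<and> \<tau> \<longlonglongrightarrow> 0 \<and>
     (\<forall>K. compact K \<longrightarrow> uniform_limit K (\<lambda>n \<zeta>. g n (w n + of_real (\<tau> n) * \<zeta>)) G sequentially)"

lemma rescaled_limit_subseq:
  assumes "rescaled_limit g w \<tau> G" "strict_mono (r :: nat \<Rightarrow> nat)"
  shows "rescaled_limit (g \<circ> r) (w \<circ> r) (\<tau> \<circ> r) G"
  using assms unfolding rescaled_limit_def
  by (auto simp: LIMSEQ_subseq_LIMSEQ
        intro: filterlim_compose[OF _ filterlim_subseq, where f = "\<lambda>n. _ n", unfolded o_def])

text \<open>The rescaled functions have spherical derivative 1 at 0 and at most 2 on growing discs.
  The first fact bounds their values at 0, the second carries the bound to every disc. Montel's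
  theorem yields an entire limit, which still has spherical derivative 1 at 0 and so is not
  constant.\<close>

lemma Zalcman:
  fixes g :: "nat \<Rightarrow> complex \<Rightarrow> complex"
  assumes hol: "\<And>n. g n holomorphic_on UNIV"
    and z: "z \<longlonglongrightarrow> e" and s: "\<And>n. sph_deriv (g n) (z n) \<ge> real (Suc n)"
  obtains \<phi> w \<tau> G where "strict_mono \<phi>" "w \<longlonglongrightarrow> e" "rescaled_limit (g \<circ> \<phi>) w \<tau> G"
proof -
  \<comment> \<open>These radii tend to 0, so the new centres have the limit of \<open>z\<close>,
    but slowly enough that \<open>r n * real (Suc n)\<close>, which measures the rescaled discs,
    tends to infinity.\<close>
  define r where "r = (\<lambda>n. 1 / sqrt (real (Suc n)))"
  have r: "r n > 0" "r n * real (Suc n) = sqrt (real (Suc n))" for n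
    by (auto simp: r_def real_div_sqrt)
  have "\<exists>w \<tau>. norm (w - z n) \<le> r n \<and> 0 < \<tau> \<and> \<tau> \<le> 1 / real (Suc n) \<and> \<tau> * sph_deriv (g n) w = 1 \<and>
     (\<forall>\<zeta>. norm \<zeta> \<le> sqrt (real (Suc n)) / 2 \<longrightarrow> \<tau> * sph_deriv (g n) (w + of_real \<tau> * \<zeta>) \<le> 2)" for n
    using Zalcman_point[OF hol s _ r(1), of n n] unfolding r(2) by (metis of_nat_0_less_iff zero_less_Suc)
  then obtain w \<tau> where w: "\<And>n. norm (w n - z n) \<le> r n" and \<tau>: "\<And>n. 0 < \<tau> n" "\<And>n. \<tau> n \<le> 1 / real (Suc n)"
      "\<And>n. \<tau> n * sph_deriv (g n) (w n) = 1"
    and b: "\<And>n \<zeta>. norm \<zeta> \<le> sqrt (real (Suc n)) / 2 \<Longrightarrow> \<tau> n * sph_deriv (g n) (w n + of_real (\<tau> n) * \<zeta>) \<le> 2"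
    by metis
  define H where "H = (\<lambda>n \<zeta>. g n (w n + of_real (\<tau> n) * \<zeta>))"
  have holH: "H n holomorphic_on A" for n A
    unfolding H_def by (rule holomorphic_affine_comp[OF hol])
  have sdH: "sph_deriv (H n) \<zeta> = \<tau> n * sph_deriv (g n) (w n + of_real (\<tau> n) * \<zeta>)" for n \<zeta>
    unfolding H_def using \<tau>(1)[of n] by (simp add: sph_deriv_rescale[OF hol])
  have sdH0: "sph_deriv (H n) 0 = 1" for n
    using \<tau>(3)[of n] by (simp add: sdH)
  have bd: "\<exists>B. \<forall>n. \<forall>x\<in>cball 0 R. norm (H n x) \<le> B" for R :: real
  proof -
    \<comment> \<open>From index \<open>N\<close> on, the bound 2 holds on the disc of radius
      \<open>\<bar>R\<bar> + 2\<close>, which leaves room for unit balls around the points of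
      \<open>cball 0 \<bar>R\<bar>\<close>. The finitely many remaining functions are bounded by
      compactness.\<close>
    obtain N :: nat where N: "(2 * (\<bar>R\<bar> + 2))\<^sup>2 \<le> real N" using real_arch_simple by blast
    have sd2: "sph_deriv (H (n + N)) x \<le> 2" if "norm x \<le> \<bar>R\<bar> + 2" for n x
    proof -
      have "(2 * (\<bar>R\<bar> + 2))\<^sup>2 \<le> real (Suc (n + N))" using N by simp
      then have "2 * (\<bar>R\<bar> + 2) \<le> sqrt (real (Suc (n + N)))" by (rule real_le_rsqrt)
      then show ?thesis unfolding sdH using that by (intro b) auto
    qed
    have "\<exists>B. \<forall>n. \<forall>x\<in>cball 0 \<bar>R\<bar>. norm (H (n + N) x) \<le> B"
    proof (rule sph_deriv_bounded_imp_bounded[where \<eta> = 1 and C = 2 and p = 0])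
      fix n and x y :: complex
      assume "x \<in> cball 0 \<bar>R\<bar>" "y \<in> ball x 1"
      then have "norm y \<le> \<bar>R\<bar> + 2"
        using norm_triangle_ineq2[of y x] by (simp add: dist_norm norm_minus_commute)
      then show "sph_deriv (H (n + N)) y \<le> 2" by (rule sd2)
    next
      fix n
      show "norm (H (n + N) 0) \<le> max 2 (growth_bound (4 / (min (1 / 2) (1 / (10 * 2)) / 4)))"
        by (rule norm_bound_of_sph_deriv[where r = 1]) (auto simp: sdH0 intro!: sd2 holH)
    qed (auto intro: holH)
    then obtain B where B: "\<And>n x. x \<in> cball 0 \<bar>R\<bar> \<Longrightarrow> norm (H (n + N) x) \<le> B" by blast
    have "\<forall>n. \<exists>b. \<forall>x\<in>cball 0 R. norm (H n x) \<le> b"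
    proof
      fix n
      have "compact (H n ` cball 0 R)"
        by (intro compact_continuous_image holomorphic_on_imp_continuous_on holH) auto
      then show "\<exists>b. \<forall>x\<in>cball 0 R. norm (H n x) \<le> b"
        by (auto dest!: compact_imp_bounded simp: bounded_iff)
    qed
    then obtain b' where b': "\<And>n x. x \<in> cball 0 R \<Longrightarrow> norm (H n x) \<le> b' n" by metis
    have "norm (H n x) \<le> max B (Max (b' ` {..N}))" if "x \<in> cball 0 R" for n x
    proof (cases "n \<le> N")
      case True
      then have "b' n \<le> Max (b' ` {..N})" by (intro Max_ge) auto
      then show ?thesis using b'[OF that, of n] by linarith
    next
      case False
      then have "norm (H (n - N + N) x) \<le> B" using that by (intro B) auto
      then show ?thesis using False by simp
    qed
    then show ?thesis by blast
  qed
  obtain G \<phi> where G: "G holomorphic_on UNIV" and \<phi>: "strict_mono (\<phi> :: nat \<Rightarrow> nat)"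
      and lim: "\<And>x. (\<lambda>n. H (\<phi> n) x) \<longlonglongrightarrow> G x"
      and ulim: "\<And>K. compact K \<Longrightarrow> uniform_limit K (H \<circ> \<phi>) G sequentially"
  proof (rule Montel[of UNIV "range H" H])
    show "\<exists>B. \<forall>h\<in>range H. \<forall>z\<in>K. norm (h z) \<le> B" if K: "compact K" for K
    proof -
      obtain R where "K \<subseteq> cball 0 R"
        using compact_imp_bounded[OF K] by (auto simp: bounded_iff subset_eq)
      then show ?thesis using bd[of R] by blast
    qed
  qed (auto intro: holH)
  have "(\<lambda>n. (deriv ^^ 1) (H (\<phi> n)) 0) \<longlonglongrightarrow> (deriv ^^ 1) G 0"
  proof (rule higher_deriv_complex_uniform_limit[where A = "ball 0 1"])
    show "uniform_limit (ball 0 1) (\<lambda>n. H (\<phi> n)) G sequentially"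
      using ulim[of "cball 0 1"] by (auto simp: o_def intro: uniform_limit_on_subset)
  qed (auto intro: holH always_eventually)
  then have "(\<lambda>n. deriv (H (\<phi> n)) 0) \<longlonglongrightarrow> deriv G 0" by simp
  moreover have "1 + (norm (G 0))\<^sup>2 \<noteq> 0"
    by (metis add_nonneg_eq_0_iff zero_le_one zero_le_power2 zero_neq_one)
  ultimately have "(\<lambda>n. sph_deriv (H (\<phi> n)) 0) \<longlonglongrightarrow> sph_deriv G 0"
    unfolding sph_deriv_def by (intro tendsto_intros lim)
  then have "sph_deriv G 0 = 1"
    by (simp add: sdH0 LIMSEQ_const_iff)
  moreover have "sph_deriv G 0 = 0" if const: "G constant_on UNIV"
  proof -
    obtain c where "G = (\<lambda>_. c)" using const by (auto simp: constant_on_def)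
    then show ?thesis by (simp add: sph_deriv_def)
  qed
  ultimately have nconst: "\<not> G constant_on UNIV" by auto
  have inv: "(\<lambda>n. 1 / real (Suc n)) \<longlonglongrightarrow> 0"
    using LIMSEQ_inverse_real_of_nat by (simp add: inverse_eq_divide)
  have \<tau>0: "\<tau> \<longlonglongrightarrow> 0"
    by (rule tendsto_sandwich[OF _ _ tendsto_const inv]) (use \<tau> in \<open>auto intro!: always_eventually intro: less_imp_le\<close>)
  have "r \<longlonglongrightarrow> 0"
    using tendsto_real_sqrt[OF inv] by (simp add: r_def real_sqrt_divide)
  then have "(\<lambda>n. w n - z n) \<longlonglongrightarrow> 0"
    by (rule Lim_null_comparison[OF always_eventually[OF allI[OF w]]])
  from tendsto_add[OF this z] have "w \<longlonglongrightarrow> e" by simp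
  have "rescaled_limit (g \<circ> \<phi>) (w \<circ> \<phi>) (\<tau> \<circ> \<phi>) G"
    unfolding rescaled_limit_def using G nconst \<tau>(1) ulim LIMSEQ_subseq_LIMSEQ[OF \<tau>0 \<phi>]
    by (auto simp: H_def o_def)
  then show ?thesis
    using that \<phi> LIMSEQ_subseq_LIMSEQ[OF \<open>w \<longlonglongrightarrow> e\<close> \<phi>] by blast
qed

text \<open>On a connected set, boundedness at one point and bounded spherical derivatives nearby
  would give boundedness everywhere. Since the sequence escapes on \<open>K\<close>, its spherical
  derivatives are unbounded within \<open>\<eta>\<close> of \<open>K\<close>, and Zalcman's lemma
  applies at an accumulation point.\<close>

lemma rescaled_limit_of_escape:
  fixes g :: "nat \<Rightarrow> complex \<Rightarrow> complex"
  assumes hol: "\<And>n. g n holomorphic_on UNIV" and K: "compact K" "connected K"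
    and z0: "z0 \<in> K" "\<And>n. norm (g n z0) \<le> B0"
    and esc: "\<And>B. \<forall>\<^sub>F n in sequentially. \<exists>z\<in>K. norm (g n z) > B" and \<eta>: "\<eta> > 0"
  obtains \<phi> e w \<tau> G k where "strict_mono \<phi>" "k \<in> K" "dist k e \<le> \<eta>" "w \<longlonglongrightarrow> e"
    "rescaled_limit (g \<circ> \<phi>) w \<tau> G"
proof -
  define P where "P = (\<lambda>m n. \<exists>u. (\<exists>k\<in>K. dist k u \<le> \<eta>) \<and> sph_deriv (g n) u \<ge> real (Suc m))"
  have ex: "\<exists>n\<ge>N. P m n" for m N
  proof (rule ccontr)
    assume "\<not> ?thesis"
    then have neg: "sph_deriv (g (n + N)) u < real (Suc m)" if "k \<in> K" "dist k u \<le> \<eta>" for n u k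
      using that unfolding P_def by (meson le_add2 not_le)
    have "\<exists>B. \<forall>n. \<forall>z\<in>K. norm (g (n + N) z) \<le> B"
      by (rule sph_deriv_bounded_imp_bounded[where \<eta> = \<eta> and C = "real (Suc m)"])
         (use neg z0 K \<eta> hol less_imp_le in \<open>auto simp: less_imp_le\<close>)
    then obtain B where B: "\<And>n z. z \<in> K \<Longrightarrow> norm (g (n + N) z) \<le> B" by blast
    obtain n where "n \<ge> N" "\<exists>z\<in>K. norm (g n z) > B"
      using esc[of B] by (auto simp: eventually_sequentially) (meson le_add1 le_add2)
    then show False using B[of _ "n - N"] by (auto simp: not_le[symmetric])
  qed
  have "\<exists>\<psi>. \<forall>m. P m (\<psi> m) \<and> \<psi> m < \<psi> (Suc m)"
    by (rule dependent_nat_choice) (use ex Suc_le_eq in blast)+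
  then obtain \<psi> where \<psi>: "strict_mono \<psi>" "\<And>m. P m (\<psi> m)"
    by (auto simp: strict_mono_Suc_iff)
  then obtain u k where u: "\<And>m. k m \<in> K" "\<And>m. dist (k m) (u m) \<le> \<eta>"
      "\<And>m. sph_deriv (g (\<psi> m)) (u m) \<ge> real (Suc m)"
    unfolding P_def by metis
  \<comment> \<open>The closed \<open>\<eta>\<close>-neighbourhood of \<open>K\<close>; its
    compactness makes the points \<open>u m\<close> accumulate.\<close>
  define T where "T = {x + y |x y. x \<in> K \<and> y \<in> cball (0::complex) \<eta>}"
  have "compact T" unfolding T_def by (intro compact_sums K compact_cball)
  moreover have "u m \<in> T" for m
  proof -
    have "u m = k m + (u m - k m) \<and> k m \<in> K \<and> u m - k m \<in> cball 0 \<eta>"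
      using u(1,2)[of m] by (simp add: dist_norm norm_minus_commute)
    then show ?thesis unfolding T_def by blast
  qed
  ultimately obtain e r where e: "e \<in> T" and r: "strict_mono (r :: nat \<Rightarrow> nat)" "(u \<circ> r) \<longlonglongrightarrow> e"
    unfolding compact_def by metis
  have "sph_deriv ((g \<circ> \<psi> \<circ> r) n) ((u \<circ> r) n) \<ge> real (Suc n)" for n
    using u(3)[of "r n"] seq_suble[OF r(1), of n] by simp
  then obtain \<phi> w \<tau> G where *: "strict_mono \<phi>" "w \<longlonglongrightarrow> e" "rescaled_limit (g \<circ> \<psi> \<circ> r \<circ> \<phi>) w \<tau> G"
    using hol by (elim Zalcman[where g = "g \<circ> \<psi> \<circ> r", OF _ r(2), rotated]) auto
  obtain k' y where "k' \<in> K" "norm y \<le> \<eta>" "e = k' + y" using e by (auto simp: T_def)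
  then have "k' \<in> K" "dist k' e \<le> \<eta>" by (auto simp: dist_norm)
  moreover have "strict_mono (\<psi> \<circ> r \<circ> \<phi>)"
    using \<psi>(1) r(1) *(1) by (intro strict_mono_o)
  ultimately show ?thesis using that *(2,3) by (metis o_assoc)
qed

section \<open>Realizing itineraries\<close>

text \<open>If \<open>h + p\<close> had no zero,
  then \<open>u = h / (h + p)\<close> would have real part above \<open>1 / 2\<close> on the frontier, contradicting the
  maximum principle for \<open>exp (- u)\<close> at a zero of \<open>h\<close>.\<close>
lemma zero_of_dominated_perturbation:
  assumes V: "open V" "bounded V"
    and h: "h holomorphic_on V" "continuous_on (closure V) h"
    and p: "p holomorphic_on V" "continuous_on (closure V) p"
    and less: "\<And>t. t \<in> frontier V \<Longrightarrow> norm (p t) < norm (h t)"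
    and t0: "t0 \<in> V" "h t0 = 0"
  shows "\<exists>t\<in>V. h t + p t = 0"
proof (rule ccontr)
  assume "\<not> ?thesis"
  then have nzV: "h t + p t \<noteq> 0" if "t \<in> V" for t using that by blast
  have nzF: "h t + p t \<noteq> 0" if "t \<in> frontier V" for t
    using less[OF that] by (metis add_eq_0_iff norm_minus_cancel order.irrefl)
  have nz: "h t + p t \<noteq> 0" if "t \<in> closure V" for t
    using that nzV nzF V(1) by (auto simp: frontier_def interior_open)
  define u where "u = (\<lambda>t. h t / (h t + p t))"
  have "norm (exp (- u t0)) \<le> exp (- (1 / 2))"
  proof (rule maximum_modulus_frontier[where S = V and f = "\<lambda>t. exp (- u t)"])
    show "(\<lambda>t. exp (- u t)) holomorphic_on interior V"
      using V(1) h(1) p(1) nzV by (auto simp: interior_open u_def intro!: holomorphic_intros)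
    show "continuous_on (closure V) (\<lambda>t. exp (- u t))"
      unfolding u_def using h(2) p(2) nz by (intro continuous_intros) auto
    fix t assume t: "t \<in> frontier V"
    have "1 - u t = p t / (h t + p t)"
      using nzF[OF t] by (simp add: u_def field_simps)
    then have "norm (1 - u t) < norm (u t)"
      using less[OF t] nzF[OF t] by (simp add: u_def norm_divide divide_strict_right_mono)
    then have "(norm (1 - u t))\<^sup>2 < (norm (u t))\<^sup>2"
      by (simp add: power_strict_mono)
    then have "Re (u t) > 1 / 2"
      by (simp add: cmod_power2) (simp add: power2_eq_square algebra_simps)
    then show "norm (exp (- u t)) \<le> exp (- (1 / 2))"
      by simp
  qed (use V t0 in auto)
  then show False
    using t0(2) by (simp add: u_def)
qed

text \<open>Entry 0 is held fixed and entry 1 is the only parameter, so that every entry is an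
  entire function of the single variable \<open>t\<close>.\<close>

fun henon_orbit :: "(complex \<Rightarrow> complex) \<Rightarrow> complex \<Rightarrow> complex \<Rightarrow> complex \<Rightarrow> nat \<Rightarrow> complex" where
  "henon_orbit f \<delta> c t 0 = c"
| "henon_orbit f \<delta> c t (Suc 0) = t"
| "henon_orbit f \<delta> c t (Suc (Suc n)) = f (henon_orbit f \<delta> c t (Suc n)) - \<delta> * henon_orbit f \<delta> c t n"

lemma funpow_henon_map:
  "(henon_map f \<delta> ^^ k) (t, c) = (henon_orbit f \<delta> c t (Suc k), henon_orbit f \<delta> c t k)"
  by (induction k) (auto simp: henon_map_def)

lemma holomorphic_henon_orbit:
  assumes "f holomorphic_on UNIV"
  shows "(\<lambda>t. henon_orbit f \<delta> c t n) holomorphic_on UNIV"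
proof (induction n rule: induct_nat_012)
  case (ge2 n)
  have "(f \<circ> (\<lambda>t. henon_orbit f \<delta> c t (Suc n))) holomorphic_on UNIV"
    by (rule holomorphic_on_compose_gen[OF ge2(2) assms]) auto
  then show ?case
    using ge2(1) by (auto simp: o_def intro!: holomorphic_intros)
qed (auto simp: holomorphic_on_ident)

lemma continuous_on_henon_orbit:
  "f holomorphic_on UNIV \<Longrightarrow> continuous_on A (\<lambda>t. henon_orbit f \<delta> c t n)"
  using holomorphic_on_imp_continuous_on[OF holomorphic_henon_orbit] continuous_on_subset by blast

text \<open>Induction on \<open>n\<close>, keeping an open set of parameters that the latest entry
  maps over the current disc, with frontier going to the bounding circle. For the pattern to
  continue, \<open>f\<close> must take the value \<open>a (Suc (Suc k)) + \<delta> * a k\<close>;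
  the error made by replacing true entries by the pattern is at most
  \<open>(1 + norm \<delta>) * \<rho>\<close>.\<close>

lemma itinerary_open_set:
  fixes f :: "complex \<Rightarrow> complex" and a q :: "nat \<Rightarrow> complex"
  assumes f: "f holomorphic_on UNIV"
    and sub: "\<And>k. cball (q k) (r k) \<subseteq> cball (a (Suc k)) \<rho>" and \<rho>: "\<rho> \<ge> 0"
    and r: "\<And>k. r k > 0"
    and far: "\<And>k z. z \<in> sphere (q k) (r k) \<Longrightarrow> norm (f z - (a (Suc (Suc k)) + \<delta> * a k)) > (1 + norm \<delta>) * \<rho>"
    and hit: "\<And>k. \<exists>z\<in>ball (q k) (r k). f z = a (Suc (Suc k)) + \<delta> * a k"
  defines "x \<equiv> henon_orbit f \<delta> (a 0)"
  shows "\<exists>V. open V \<and> bounded V \<and> (\<forall>t\<in>closure V. \<forall>k\<le>n. x t (Suc k) \<in> cball (q k) (r k)) \<and>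
    (\<forall>t\<in>frontier V. x t (Suc n) \<in> sphere (q n) (r n)) \<and> (\<forall>y\<in>ball (q n) (r n). \<exists>t\<in>V. x t (Suc n) = y)"
proof (induction n)
  case 0
  have "(\<forall>t\<in>closure (ball (q 0) (r 0)). \<forall>k\<le>0. x t (Suc k) \<in> cball (q k) (r k)) \<and>
    (\<forall>t\<in>frontier (ball (q 0) (r 0)). x t (Suc 0) \<in> sphere (q 0) (r 0)) \<and>
    (\<forall>y\<in>ball (q 0) (r 0). \<exists>t\<in>ball (q 0) (r 0). x t (Suc 0) = y)"
    using r[of 0] by (simp add: x_def)
  then show ?case
    by (intro exI[of _ "ball (q 0) (r 0)"]) auto
next
  case (Suc n)
  then obtain V where V: "open V" "bounded V"
    and itin: "\<And>t k. t \<in> closure V \<Longrightarrow> k \<le> n \<Longrightarrow> x t (Suc k) \<in> cball (q k) (r k)"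
    and fr: "\<And>t. t \<in> frontier V \<Longrightarrow> x t (Suc n) \<in> sphere (q n) (r n)"
    and onto: "\<And>y. y \<in> ball (q n) (r n) \<Longrightarrow> \<exists>t\<in>V. x t (Suc n) = y"
    by metis
  have hol: "(\<lambda>t. x t k) holomorphic_on A" for k A
    unfolding x_def using holomorphic_henon_orbit[OF f] holomorphic_on_subset by blast
  have cont: "continuous_on A (\<lambda>t. x t k)" for k A
    unfolding x_def by (rule continuous_on_henon_orbit[OF f])
  have step: "x t (Suc (Suc n)) = f (x t (Suc n)) - \<delta> * x t n" for t
    by (simp add: x_def)
  \<comment> \<open>Disc \<open>k\<close> constrains entry \<open>Suc k\<close>, so no disc covers
    entry 0; that entry equals \<open>a 0\<close> exactly.\<close>
  have prev: "norm (\<delta> * (a n - x t n)) \<le> norm \<delta> * \<rho>" if "t \<in> closure V" for t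
  proof -
    have "norm (a n - x t n) \<le> \<rho>"
    proof (cases n)
      case 0
      then show ?thesis using \<rho> by (simp add: x_def)
    next
      case (Suc m)
      then have "x t n \<in> cball (a n) \<rho>"
        using itin[OF that, of m] sub[of m] by auto
      then show ?thesis by (simp add: dist_norm)
    qed
    then show ?thesis by (simp add: norm_mult mult_left_mono)
  qed
  define v where "v = a (Suc (Suc n)) + \<delta> * a n"
  define V' where "V' = V \<inter> (\<lambda>t. x t (Suc (Suc n))) -` ball (q (Suc n)) (r (Suc n))"
  have oV': "open V'"
    unfolding V'_def by (rule continuous_open_preimage[OF cont V(1) open_ball])
  have "closed (closure V \<inter> (\<lambda>t. x t (Suc (Suc n))) -` cball (q (Suc n)) (r (Suc n)))"
    by (rule continuous_closed_preimage[OF cont closed_closure closed_cball])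
  moreover have "V' \<subseteq> closure V \<inter> (\<lambda>t. x t (Suc (Suc n))) -` cball (q (Suc n)) (r (Suc n))"
    unfolding V'_def using closure_subset by fastforce
  ultimately have cl: "closure V' \<subseteq> closure V \<inter> (\<lambda>t. x t (Suc (Suc n))) -` cball (q (Suc n)) (r (Suc n))"
    by (rule closure_minimal[rotated])
  have big: "norm (f (x t (Suc n)) - v) > (1 + norm \<delta>) * \<rho>" if "t \<in> frontier V" for t
    unfolding v_def by (rule far[OF fr[OF that]])
  \<comment> \<open>On the frontier of \<open>V\<close> the next entry is farther than
    \<open>\<rho>\<close> from \<open>a (Suc (Suc n))\<close>. Frontier points of \<open>V'\<close>
    therefore lie in \<open>V\<close>, and only the constraint on the new entry can be
    tight.\<close>
  have frV': "x t (Suc (Suc n)) \<in> sphere (q (Suc n)) (r (Suc n))" if t: "t \<in> frontier V'" for t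
  proof -
    have tc: "t \<in> closure V" "x t (Suc (Suc n)) \<in> cball (q (Suc n)) (r (Suc n))" "t \<notin> V'"
      using t cl oV' by (auto simp: frontier_def interior_open)
    have "t \<in> V"
    proof (rule ccontr)
      assume "t \<notin> V"
      then have "t \<in> frontier V"
        using tc V(1) by (simp add: frontier_def interior_open)
      then have "norm (f (x t (Suc n)) - v) > (1 + norm \<delta>) * \<rho>" by (rule big)
      moreover have "norm (x t (Suc (Suc n)) - a (Suc (Suc n))) \<le> \<rho>"
        using subsetD[OF sub tc(2)] by (simp add: dist_norm norm_minus_commute)
      moreover have "f (x t (Suc n)) - v = (x t (Suc (Suc n)) - a (Suc (Suc n))) - \<delta> * (a n - x t n)"
        by (simp add: step v_def algebra_simps)
      ultimately show False
        using prev[OF tc(1)] norm_triangle_ineq4[of "x t (Suc (Suc n)) - a (Suc (Suc n))" "\<delta> * (a n - x t n)"]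
        by (simp add: algebra_simps)
    qed
    then show ?thesis using tc by (auto simp: V'_def)
  qed
  have ontoV': "\<exists>t\<in>V'. x t (Suc (Suc n)) = y" if y: "y \<in> ball (q (Suc n)) (r (Suc n))" for y
  proof -
    obtain z where z: "z \<in> ball (q n) (r n)" "f z = v"
      using hit[of n] by (auto simp: v_def)
    obtain t0 where t0: "t0 \<in> V" "x t0 (Suc n) = z" using onto[OF z(1)] by blast
    have "(f \<circ> (\<lambda>t. x t (Suc n))) holomorphic_on A" for A
      by (rule holomorphic_on_compose_gen[OF hol f]) auto
    then have holh: "(\<lambda>t. f (x t (Suc n)) - v) holomorphic_on A" for A
      by (auto simp: o_def intro!: holomorphic_intros)
    have holp: "(\<lambda>t. v - \<delta> * x t n - y) holomorphic_on A" for A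
      by (intro holomorphic_intros hol)
    \<comment> \<open>The first bracket has a zero in \<open>V\<close>, because
      \<open>x t (Suc n)\<close> covers the disc containing a solution of \<open>f z = v\<close>.
      The second collects the deviations of \<open>y\<close> and \<open>x t n\<close> from the
      pattern.\<close>
    have "\<exists>t\<in>V. (f (x t (Suc n)) - v) + (v - \<delta> * x t n - y) = 0"
    proof (rule zero_of_dominated_perturbation[where V = V and p = "\<lambda>t. v - \<delta> * x t n - y"
          and h = "\<lambda>t. f (x t (Suc n)) - v"])
      fix t assume t: "t \<in> frontier V"
      then have "t \<in> closure V" by (simp add: frontier_def)
      have "norm (a (Suc (Suc n)) - y) \<le> \<rho>"
        using subsetD[OF sub subsetD[OF ball_subset_cball y]] by (simp add: dist_norm)
      moreover have "v - \<delta> * x t n - y = (a (Suc (Suc n)) - y) + \<delta> * (a n - x t n)"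
        by (simp add: v_def algebra_simps)
      ultimately have "norm (v - \<delta> * x t n - y) \<le> (1 + norm \<delta>) * \<rho>"
        using prev[OF \<open>t \<in> closure V\<close>] norm_triangle_ineq[of "a (Suc (Suc n)) - y" "\<delta> * (a n - x t n)"]
        by (simp add: algebra_simps)
      then show "norm (v - \<delta> * x t n - y) < norm (f (x t (Suc n)) - v)"
        using big[OF t] by linarith
    qed (use V t0 z holh holp holomorphic_on_imp_continuous_on in auto)
    then obtain t where "t \<in> V" "x t (Suc (Suc n)) = y"
      by (force simp: step algebra_simps)
    then show ?thesis using y by (auto simp: V'_def)
  qed
  have "bounded V'" using V(2) bounded_subset unfolding V'_def by blast
  moreover have "\<forall>t\<in>closure V'. \<forall>k\<le>Suc n. x t (Suc k) \<in> cball (q k) (r k)"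
    using cl itin by (auto simp: le_Suc_eq)
  ultimately show ?case
    using oV' frV' ontoV' by blast
qed

text \<open>The parameters that obey finitely many of the discs form nested nonempty compact sets;
  any common point serves.\<close>

lemma itinerary_realized:
  fixes f :: "complex \<Rightarrow> complex" and a q :: "nat \<Rightarrow> complex"
  assumes f: "f holomorphic_on UNIV"
    and sub: "\<And>k. cball (q k) (r k) \<subseteq> cball (a (Suc k)) \<rho>" and \<rho>: "\<rho> \<ge> 0"
    and r: "\<And>k. r k > 0"
    and far: "\<And>k z. z \<in> sphere (q k) (r k) \<Longrightarrow> norm (f z - (a (Suc (Suc k)) + \<delta> * a k)) > (1 + norm \<delta>) * \<rho>"
    and hit: "\<And>k. \<exists>z\<in>ball (q k) (r k). f z = a (Suc (Suc k)) + \<delta> * a k"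
  shows "\<exists>t. \<forall>k. henon_orbit f \<delta> (a 0) t (Suc k) \<in> cball (q k) (r k)"
proof -
  let ?x = "henon_orbit f \<delta> (a 0)"
  define T where "T = (\<lambda>n. \<Inter>k\<in>{..n}. {t. ?x t (Suc k) \<in> cball (q k) (r k)})"
  have clos: "closed {t. ?x t (Suc k) \<in> cball (q k) (r k)}" for k
    using continuous_closed_preimage[OF continuous_on_henon_orbit[OF f, of UNIV] closed_UNIV closed_cball]
    by (simp add: vimage_def)
  have "\<Inter>(range T) \<noteq> {}"
  proof (rule compact_nest)
    fix n
    \<comment> \<open>Entry 1 is the parameter itself, so the condition for \<open>k = 0\<close>
      already bounds the set.\<close>
    have "T n = cball (q 0) (r 0) \<inter> T n" unfolding T_def by force
    moreover have "closed (T n)" unfolding T_def by (intro closed_INT ballI clos)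
    ultimately show "compact (T n)" by (metis compact_Int_closed compact_cball)
    obtain V where V: "\<forall>t\<in>closure V. \<forall>k\<le>n. ?x t (Suc k) \<in> cball (q k) (r k)"
        "\<forall>y\<in>ball (q n) (r n). \<exists>t\<in>V. ?x t (Suc n) = y"
      using itinerary_open_set[where f = f and q = q and r = r and a = a and \<rho> = \<rho> and \<delta> = \<delta> and n = n, OF assms]
      by blast
    obtain t where "t \<in> V" using V(2) r[of n] by (metis centre_in_ball)
    then have "t \<in> closure V" using closure_subset by auto
    then have "t \<in> T n" using V(1) by (auto simp: T_def)
    then show "T n \<noteq> {}" by auto
  qed (auto simp: T_def)
  then show ?thesis by (auto simp: T_def)
qed

section \<open>Entropy from independently chosen symbols\<close>

lemma eln_mono: "x \<le> y \<Longrightarrow> eln x \<le> eln y"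
  by (cases x; cases y) (auto simp: eln_def)

text \<open>Along the multiples of \<open>P\<close> the growth rate is at least
  \<open>ln N / P\<close>, and a limsup dominates that of each subsequence.\<close>

lemma htop_compact_ge_of_exponential_growth:
  fixes g :: "'a::metric_space \<Rightarrow> 'a"
  assumes "\<epsilon> > 0" "P > 0" "N > 0"
    and E: "\<And>m. \<exists>E. finite E \<and> E \<subseteq> X \<and> separated_set g (m * P) \<epsilon> E \<and> card E = N ^ m"
  shows "htop_compact X g \<ge> ereal (ln (real N) / real P)"
proof -
  define u where "u = (\<lambda>n. eln (max_sep_card X g n \<epsilon>) / ereal (real n))"
  \<comment> \<open>The shift by one keeps the time, which is divided by, away from 0.\<close>
  define r where "r = (\<lambda>m. Suc m * P)"
  have "strict_mono r" using \<open>P > 0\<close> by (simp add: r_def strict_mono_Suc_iff)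
  have "ereal (ln (real N) / real P) \<le> (u \<circ> r) m" for m
  proof -
    obtain E where E': "finite E" "E \<subseteq> X" "separated_set g (r m) \<epsilon> E" "card E = N ^ Suc m"
      using E[of "Suc m"] by (auto simp: r_def)
    have "ereal (real (card E)) \<le> max_sep_card X g (r m) \<epsilon>"
      unfolding max_sep_card_def by (rule Sup_upper) (use E' in blast)
    then have "eln (ereal (real (N ^ Suc m))) \<le> eln (max_sep_card X g (r m) \<epsilon>)"
      using E'(4) by (intro eln_mono) simp
    moreover have "eln (ereal (real (N ^ Suc m))) = ereal (real (Suc m) * ln (real N))"
    proof -
      have "real (N ^ Suc m) > 0" using \<open>N > 0\<close> by simp
      then show ?thesis
        unfolding eln_def using \<open>N > 0\<close> by (simp add: not_le ln_mult ln_realpow algebra_simps del: power_Suc)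
    qed
    ultimately have "ereal (real (Suc m) * ln (real N)) / ereal (real (r m)) \<le> (u \<circ> r) m"
      unfolding u_def o_def using \<open>P > 0\<close>
      by (intro ereal_divide_right_mono) (simp_all add: r_def add_pos_nonneg)
    moreover have "real (Suc m) * ln (real N) / real (r m) = ln (real N) / real P"
      by (simp add: r_def del: of_nat_Suc mult_Suc)
    moreover have "r m > 0" using \<open>P > 0\<close> by (simp add: r_def)
    ultimately show ?thesis by simp
  qed
  then have "ereal (ln (real N) / real P) \<le> limsup (u \<circ> r)"
    by (intro le_Limsup) auto
  also have "\<dots> \<le> limsup u"
    by (rule limsup_subseq_mono[OF \<open>strict_mono r\<close>])
  also have "\<dots> \<le> htop_compact X g"
    unfolding htop_compact_def u_def by (rule SUP_upper) (use \<open>\<epsilon> > 0\<close> in auto)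
  finally show ?thesis .
qed

text \<open>One of \<open>N\<close> symbols is free at each multiple of \<open>P\<close>, so words
  of length \<open>m\<close> give \<open>N ^ m\<close> orbits. Different words put the orbits into
  discs more than \<open>\<epsilon>\<close> apart at some time \<open>j * P\<close>.\<close>

lemma htop_henon_ge_of_horseshoe:
  fixes f :: "complex \<Rightarrow> complex" and a :: "nat \<Rightarrow> complex" and q :: "nat \<Rightarrow> nat \<Rightarrow> complex"
  assumes f: "f holomorphic_on UNIV"
    and pos: "P > 0" "N > 0" "\<epsilon> > 0" "\<rho> \<ge> 0"
    and M: "\<And>k. norm (a k) \<le> M"
    and sub: "\<And>k s. s < N \<Longrightarrow> cball (q k s) (r k s) \<subseteq> cball (a (Suc k)) \<rho>"
    and r: "\<And>k s. s < N \<Longrightarrow> r k s > 0"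
    and far: "\<And>k s z. s < N \<Longrightarrow> z \<in> sphere (q k s) (r k s) \<Longrightarrow>
      norm (f z - (a (Suc (Suc k)) + \<delta> * a k)) > (1 + norm \<delta>) * \<rho>"
    and hit: "\<And>k s. s < N \<Longrightarrow> \<exists>z\<in>ball (q k s) (r k s). f z = a (Suc (Suc k)) + \<delta> * a k"
    and sep: "\<And>j s s' z z'. s < N \<Longrightarrow> s' < N \<Longrightarrow> s \<noteq> s' \<Longrightarrow> z \<in> cball (q (j * P) s) (r (j * P) s) \<Longrightarrow>
      z' \<in> cball (q (j * P) s') (r (j * P) s') \<Longrightarrow> dist z z' > \<epsilon>"
  shows "htop UNIV (henon_map f \<delta>) \<ge> ereal (ln (real N) / real P)"
proof -
  let ?F = "henon_map f \<delta>"
  define K where "K = cball (0::complex) (M + \<rho>) \<times> cball (0::complex) (M + \<rho>)"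
  \<comment> \<open>The points whose whole forward orbit stays in the bidisc \<open>K\<close>: a
    closed subset of a compact set, mapped into itself.\<close>
  define X where "X = (\<Inter>k. (?F ^^ k) -` K)"
  have "continuous_on UNIV f" using f by (rule holomorphic_on_imp_continuous_on)
  then have "continuous_on UNIV (\<lambda>p::complex \<times> complex. f (fst p))"
    by (rule continuous_on_compose2) (auto intro: continuous_on_fst continuous_on_id)
  then have contF: "continuous_on UNIV ?F"
    unfolding henon_map_def case_prod_unfold by (intro continuous_intros)
  have contFk: "continuous_on UNIV (?F ^^ k)" for k
  proof (induction k)
    case (Suc k)
    then have "continuous_on UNIV (?F \<circ> (?F ^^ k))"
      using contF by (intro continuous_on_compose) (auto intro: continuous_on_subset)
    then show ?case by simp
  qed (simp add: continuous_on_id)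
  have "compact K" unfolding K_def by (intro compact_Times compact_cball)
  have "closed X" unfolding X_def
    by (intro closed_INT ballI closed_vimage)
       (use contFk \<open>compact K\<close> compact_imp_closed in auto)
  have Xk: "(?F ^^ k) x \<in> K" if "x \<in> X" for x k
    using that unfolding X_def by blast
  have "X \<subseteq> K"
    using Xk[of _ 0] by auto
  with \<open>closed X\<close> have "compact X" using \<open>compact K\<close> by (metis compact_Int_closed inf.absorb2)
  have "(?F ^^ k) (?F x) \<in> K" if "x \<in> X" for x k
    using Xk[OF that, of "Suc k"] by (simp add: funpow_swap1)
  then have "?F ` X \<subseteq> X"
    unfolding X_def by blast
  have "htop_compact X ?F \<ge> ereal (ln (real N) / real P)"
  proof (rule htop_compact_ge_of_exponential_growth[where \<epsilon> = \<epsilon>])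
    fix m :: nat
    define S where "S = {..<m} \<rightarrow>\<^sub>E {..<N}"
    \<comment> \<open>The word gives one symbol per block of \<open>P\<close> steps; after its last
      block the symbol 0 fills up the infinite itinerary.\<close>
    define s where "s = (\<lambda>\<sigma> k. if k div P < m then \<sigma> (k div P) else (0::nat))"
    have sN: "s \<sigma> k < N" if "\<sigma> \<in> S" for \<sigma> k
      using that pos by (auto simp: s_def S_def)
    have "\<exists>t. \<forall>k. henon_orbit f \<delta> (a 0) t (Suc k) \<in> cball (q k (s \<sigma> k)) (r k (s \<sigma> k))" if "\<sigma> \<in> S" for \<sigma>
      using that sN[OF that]
      by (intro itinerary_realized[where f = f and a = a and \<delta> = \<delta> and \<rho> = \<rho> and q = "\<lambda>k. q k (s \<sigma> k)" and r = "\<lambda>k. r k (s \<sigma> k)"]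
          f pos sub r far hit)
    then obtain t where t: "\<And>\<sigma> k. \<sigma> \<in> S \<Longrightarrow>
        henon_orbit f \<delta> (a 0) (t \<sigma>) (Suc k) \<in> cball (q k (s \<sigma> k)) (r k (s \<sigma> k))"
      by metis
    define p where "p = (\<lambda>\<sigma>. (t \<sigma>, a 0))"
    have sepp: "\<exists>k<m * P. dist ((?F ^^ k) (p \<sigma>)) ((?F ^^ k) (p \<sigma>')) > \<epsilon>"
      if \<sigma>: "\<sigma> \<in> S" "\<sigma>' \<in> S" "\<sigma> \<noteq> \<sigma>'" for \<sigma> \<sigma>'
    proof -
      obtain j where j: "j < m" "\<sigma> j \<noteq> \<sigma>' j"
        using \<sigma> unfolding S_def by (metis PiE_ext lessThan_iff)
      have "s \<sigma> (j * P) = \<sigma> j" "s \<sigma>' (j * P) = \<sigma>' j"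
        using j pos by (auto simp: s_def)
      then have "\<epsilon> < dist (henon_orbit f \<delta> (a 0) (t \<sigma>) (Suc (j * P))) (henon_orbit f \<delta> (a 0) (t \<sigma>') (Suc (j * P)))"
        using j t[OF \<sigma>(1), of "j * P"] t[OF \<sigma>(2), of "j * P"] sN[OF \<sigma>(1), of "j * P"] sN[OF \<sigma>(2), of "j * P"]
        by (intro sep[of "\<sigma> j" "\<sigma>' j" _ j]) auto
      \<comment> \<open>The first coordinate at time \<open>k\<close> is entry \<open>Suc k\<close>,
        the one that disc \<open>k\<close> constrains, so no index shift remains.\<close>
      also have "\<dots> \<le> dist ((?F ^^ (j * P)) (p \<sigma>)) ((?F ^^ (j * P)) (p \<sigma>'))"
        unfolding p_def funpow_henon_map by (metis dist_fst_le fst_conv)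
      finally show ?thesis using j pos by (intro exI[of _ "j * P"]) auto
    qed
    have inj: "inj_on p S"
      using sepp pos by (force simp: inj_on_def)
    have "p \<sigma> \<in> X" if "\<sigma> \<in> S" for \<sigma>
    proof -
      have orb: "norm (henon_orbit f \<delta> (a 0) (t \<sigma>) k) \<le> M + \<rho>" for k
      proof (cases k)
        case 0
        then show ?thesis using M[of 0] pos by simp
      next
        case (Suc i)
        then have "henon_orbit f \<delta> (a 0) (t \<sigma>) k \<in> cball (a k) \<rho>"
          using subsetD[OF sub[OF sN[OF that]] t[OF that, of i]] by (simp only:)
        then show ?thesis
          using M[of k] norm_triangle_sub[of "henon_orbit f \<delta> (a 0) (t \<sigma>) k" "a k"]
          by (simp add: dist_norm norm_minus_commute)
      qed
      show ?thesis
        unfolding X_def p_def by (auto simp: funpow_henon_map K_def orb simp del: henon_orbit.simps)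
    qed
    moreover have "finite S" "card S = N ^ m"
      by (simp_all add: S_def card_PiE finite_PiE)
    ultimately show "\<exists>E. finite E \<and> E \<subseteq> X \<and> separated_set ?F (m * P) \<epsilon> E \<and> card E = N ^ m"
      using sepp inj by (intro exI[of _ "p ` S"]) (auto simp: separated_set_def card_image)
  qed (use pos in auto)
  also have "htop_compact X ?F \<le> htop UNIV ?F"
  proof -
    have X: "X \<subseteq> UNIV \<and> compact X \<and> ?F ` X \<subseteq> X"
      using \<open>compact X\<close> \<open>?F ` X \<subseteq> X\<close> by simp
    then have "htop UNIV ?F = (SUP X\<in>{X. X \<subseteq> UNIV \<and> compact X \<and> ?F ` X \<subseteq> X}. htop_compact X ?F)"
      unfolding htop_def by (intro if_P) blast
    then show ?thesis using X by (auto intro!: SUP_upper)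
  qed
  finally show ?thesis .
qed

section \<open>Rescaled limits of transcendental functions\<close>

lemma not_transcendental_entire_if_sum:
  assumes "\<And>z. f z = (\<Sum>i\<le>n. c i * z ^ i)"
  shows "\<not> transcendental_entire f"
proof -
  have "f z = poly (\<Sum>i\<le>n. monom (c i) i) z" for z
    by (simp add: assms poly_sum poly_monom)
  then show ?thesis unfolding transcendental_entire_def by blast
qed

text \<open>Some Taylor coefficient of order \<open>m > k\<close> does not vanish, and Cauchy's
  inequality for it fails on large circles if \<open>norm (f z)\<close> stays below
  \<open>B * r ^ k\<close>.\<close>

lemma transcendental_entire_growth:
  assumes f: "transcendental_entire f"
  shows "\<forall>\<^sub>F r in at_top. \<exists>z\<in>sphere 0 r. norm (f z) > B * r ^ k"
proof -
  have hol: "f holomorphic_on A" for A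
    using f unfolding transcendental_entire_def by (meson holomorphic_on_subset subset_UNIV)
  have "\<exists>m>k. (deriv ^^ m) f 0 \<noteq> 0"
  proof (rule ccontr)
    assume neg: "\<not> ?thesis"
    have "f z = (\<Sum>i\<le>k. (deriv ^^ i) f 0 / fact i * z ^ i)" for z
    proof -
      have "(\<lambda>i. (deriv ^^ i) f 0 / fact i * (z - 0) ^ i) sums f z"
        by (rule holomorphic_power_series[where r = "norm z + 1"]) (auto intro: hol)
      moreover have "(\<lambda>i. (deriv ^^ i) f 0 / fact i * (z - 0) ^ i) sums
          (\<Sum>i\<le>k. (deriv ^^ i) f 0 / fact i * (z - 0) ^ i)"
        by (rule sums_finite) (use neg in auto)
      ultimately show ?thesis using sums_unique2 by fastforce
    qed
    from not_transcendental_entire_if_sum[OF this] f show False by blast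
  qed
  then obtain m where m: "m > k" "(deriv ^^ m) f 0 \<noteq> 0" by blast
  define A where "A = norm ((deriv ^^ m) f 0)"
  have "A > 0" using m by (simp add: A_def)
  show ?thesis
    unfolding eventually_at_top_dense
  \<comment> \<open>For \<open>r > 1\<close>, Cauchy's inequality would give
    \<open>A * r \<le> fact m * \<bar>B\<bar>\<close>; the threshold is where this breaks
    down.\<close>
  proof (intro exI[of _ "max 1 (fact m * \<bar>B\<bar> / A)"] allI impI, rule ccontr)
    fix r assume r: "max 1 (fact m * \<bar>B\<bar> / A) < r" and neg: "\<not> (\<exists>z\<in>sphere 0 r. norm (f z) > B * r ^ k)"
    have "r > 0" using r by simp
    have "A \<le> fact m * (B * r ^ k) / r ^ m"
      unfolding A_def
      by (rule Cauchy_inequality) (use \<open>r > 0\<close> neg in \<open>auto simp: dist_norm not_less intro: hol holomorphic_on_imp_continuous_on\<close>)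
    also have "r ^ m = r ^ (m - k) * r ^ k"
      using m by (simp flip: power_add)
    finally have "A * r ^ (m - k) \<le> fact m * B"
      using \<open>r > 0\<close> by (simp add: field_simps)
    moreover have "A * r ^ 1 \<le> A * r ^ (m - k)"
      using r m \<open>A > 0\<close> by (intro mult_left_mono power_increasing) auto
    ultimately have "A * r \<le> fact m * \<bar>B\<bar>"
      by (smt (verit) fact_ge_zero mult_left_mono power_one_right)
    then show False using r \<open>A > 0\<close> by (simp add: field_simps)
  qed
qed

text \<open>Otherwise \<open>inverse (f z)\<close> would tend to 0 at infinity, making infinity a
  pole and \<open>f\<close> a polynomial.\<close>

lemma transcendental_entire_small_values:
  assumes f: "transcendental_entire f"
  obtains z where "norm z \<ge> R" "norm (f z) \<le> norm z"
proof (rule ccontr)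
  assume neg: "\<not> thesis"
  then have big: "norm (f z) > norm z" if "norm z \<ge> R" for z
    using that by (meson not_le \<open>\<And>z. R \<le> norm z \<Longrightarrow> norm (f z) \<le> norm z \<Longrightarrow> thesis\<close>)
  have "((inverse \<circ> f) \<longlongrightarrow> 0) at_infinity"
  proof (rule Lim_null_comparison)
    show "\<forall>\<^sub>F z in at_infinity. norm ((inverse \<circ> f) z) \<le> norm (inverse z)"
      unfolding eventually_at_infinity
    proof (intro exI[of _ "max R 1"] allI impI)
      fix z :: complex assume "max R 1 \<le> norm z"
      then have "norm z < norm (f z)" "0 < norm z" using big[of z] by auto
      then show "norm ((inverse \<circ> f) z) \<le> norm (inverse z)"
        by (simp add: norm_inverse le_imp_inverse_le less_imp_le)
    qed
    show "((\<lambda>z::complex. norm (inverse z)) \<longlongrightarrow> 0) at_infinity"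
      using tendsto_norm_zero[OF tendsto_inverse_0] by simp
  qed
  moreover have "f holomorphic_on UNIV" using f by (simp add: transcendental_entire_def)
  ultimately obtain a n where "\<And>z. f z = (\<Sum>i\<le>n. a i * z ^ i)"
    using pole_at_infinity by metis
  from not_transcendental_entire_if_sum[OF this] f show False by blast
qed

text \<open>On the unit circle \<open>\<lambda>z. f (W n * z) / W n\<close> is bounded at \<open>1\<close> but unbounded as a whole, if
  \<open>norm (f (W n)) \<le> norm (W n)\<close>.\<close>
lemma rescaled_limit_off_origin:
  assumes f: "transcendental_entire f"
  obtains \<Lambda> e w \<tau> H where "\<And>n. norm (\<Lambda> n) \<ge> C + real n" "e \<noteq> 0" "w \<longlonglongrightarrow> e"
    "rescaled_limit (\<lambda>n z. f (\<Lambda> n * z) / \<Lambda> n) w \<tau> H"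
proof -
  have hol: "f holomorphic_on UNIV"
    using f by (simp add: transcendental_entire_def)
  have "\<exists>z. norm z \<ge> max C 0 + 1 + real n \<and> norm (f z) \<le> norm z" for n
    using transcendental_entire_small_values[OF f] by metis
  then obtain W where W: "\<And>n. norm (W n) \<ge> max C 0 + 1 + real n" "\<And>n. norm (f (W n)) \<le> norm (W n)"
    by metis
  have W0: "norm (W n) > 0" for n using W(1)[of n] by linarith
  define g where "g = (\<lambda>n z. f (W n * z) / W n)"
  have "filterlim (\<lambda>n. norm (W n)) at_top sequentially"
    by (rule filterlim_at_top_mono[OF filterlim_real_sequentially])
       (auto intro!: always_eventually order_trans[OF _ W(1)])
  then have grow: "\<forall>\<^sub>F n in sequentially. \<exists>z\<in>sphere 0 (norm (W n)). norm (f z) > B * norm (W n) ^ 1" for B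
    by (rule eventually_compose_filterlim[OF transcendental_entire_growth[OF f]])
  obtain \<phi> e w \<tau> G k where \<phi>: "strict_mono \<phi>" and k: "k \<in> sphere 0 1" "dist k e \<le> 1 / 2"
    and w: "w \<longlonglongrightarrow> e" and lim: "rescaled_limit (g \<circ> \<phi>) w \<tau> G"
  proof (rule rescaled_limit_of_escape[where g = g and K = "sphere 0 1" and ?z0.0 = 1 and ?B0.0 = 1 and \<eta> = "1 / 2"])
    show "g n holomorphic_on UNIV" for n
      unfolding g_def using holomorphic_affine_comp[OF hol, of 0 "W n" UNIV]
      by (auto intro!: holomorphic_intros)
    show "connected (sphere (0::complex) 1)"
      by (rule connected_sphere) simp
    show "norm (g n 1) \<le> 1" for n
      using W(2)[of n] W0[of n] by (simp add: g_def norm_divide divide_le_eq)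
    fix B
    show "\<forall>\<^sub>F n in sequentially. \<exists>z\<in>sphere 0 1. norm (g n z) > B"
      using grow[of B]
    proof eventually_elim
      case (elim n)
      then obtain z where z: "norm z = norm (W n)" "norm (f z) > B * norm (W n)" by auto
      have "z / W n \<in> sphere 0 1" using z(1) W0[of n] by (auto simp: norm_divide)
      moreover have "norm (g n (z / W n)) > B"
        using z(2) W0[of n] by (auto simp: g_def norm_divide less_divide_eq)
      ultimately show ?case by blast
    qed
  qed auto
  \<comment> \<open>The choice \<open>\<eta> = 1 / 2\<close> around the unit circle keeps
    \<open>e\<close> away from the origin.\<close>
  have "1 \<le> norm e + 1 / 2"
    using k norm_triangle_sub[of k e] by (simp add: dist_norm)
  then have "e \<noteq> 0" by auto
  moreover have "norm ((W \<circ> \<phi>) n) \<ge> C + real n" for n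
    using W(1)[of "\<phi> n"] seq_suble[OF \<phi>, of n] by simp
  moreover have "rescaled_limit (\<lambda>n z. f ((W \<circ> \<phi>) n * z) / (W \<circ> \<phi>) n) w \<tau> G"
    using lim by (simp add: g_def o_def)
  ultimately show ?thesis using w that by blast
qed

section \<open>Many rescaled limits at the scale where the maximum modulus is reached\<close>

lemma maximum_modulus_sphere:
  assumes "g holomorphic_on UNIV" "s > 0" "z \<in> cball 0 s" "norm (g z) > B"
  shows "\<exists>z\<in>sphere 0 s. norm (g z) > (B::real)"
proof (rule ccontr)
  assume neg: "\<not> ?thesis"
  have "norm (g z) \<le> B"
  proof (rule maximum_modulus_frontier[where S = "cball 0 s" and f = g])
    show "g holomorphic_on interior (cball 0 s)"
      using assms(1) by (rule holomorphic_on_subset) auto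
    show "continuous_on (closure (cball 0 s)) g"
      by (meson assms(1) continuous_on_subset holomorphic_on_imp_continuous_on subset_UNIV)
    show "norm (g x) \<le> B" if "x \<in> frontier (cball 0 s)" for x
      using that neg \<open>s > 0\<close> by (auto simp: not_less)
  qed (use assms in auto)
  then show False using assms(4) by simp
qed

text \<open>Given finitely many points where rescaled limits have been found, a circle joined with a radial
  segment reaching into the unit disc can be chosen to avoid all of them; the sequence is bounded at one
  end of the segment and unbounded on the circle, which yields a further point.\<close>
lemma many_rescaled_limits:
  fixes g :: "nat \<Rightarrow> complex \<Rightarrow> complex"
  assumes hol: "\<And>n. g n holomorphic_on UNIV"
    and le1: "\<And>n z. z \<in> ball 0 1 \<Longrightarrow> norm (g n z) \<le> 1"
    and esc: "\<And>s B. s > 1 \<Longrightarrow> \<forall>\<^sub>F n in sequentially. \<exists>z\<in>cball 0 s. norm (g n z) > B"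
  shows "\<exists>\<phi> e w \<tau> G. strict_mono \<phi> \<and> inj_on e {..<M::nat} \<and>
    (\<forall>i<M. w i \<longlonglongrightarrow> e i \<and> rescaled_limit (g \<circ> \<phi>) (w i) (\<tau> i) (G i))"
proof (induction M)
  case 0
  show ?case by (auto intro: strict_mono_id)
next
  case (Suc M)
  then obtain \<phi> e w \<tau> G where \<phi>: "strict_mono \<phi>" and inj: "inj_on e {..<M}"
    and lim: "\<And>i. i < M \<Longrightarrow> w i \<longlonglongrightarrow> e i" "\<And>i. i < M \<Longrightarrow> rescaled_limit (g \<circ> \<phi>) (w i) (\<tau> i) (G i)"
    by blast
  define E where "E = e ` {..<M}"
  have finE: "finite E" by (simp add: E_def)
  \<comment> \<open>Finitely many points rule out only finitely many radii, and below likewise only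
    finitely many directions \<open>u\<close>.\<close>
  have "infinite ({1<..<2::real} - norm ` E)"
    using finE by (intro Diff_infinite_finite) (auto simp: infinite_Ioo)
  then obtain s where s: "1 < s" "s < 2" "s \<notin> norm ` E"
    by (metis DiffE finite.emptyI greaterThanLessThan_iff infinite_imp_nonempty ex_in_conv)
  have "infinite (sphere (0::complex) 1)"
  proof
    assume "finite (sphere (0::complex) 1)"
    moreover have "connected (sphere (0::complex) 1)" by (rule connected_sphere) simp
    moreover have "1 \<in> sphere (0::complex) 1" "-1 \<in> sphere (0::complex) 1" "(1::complex) \<noteq> -1" by auto
    ultimately show False using connected_finite_iff_sing by (metis empty_iff singletonD)
  qed
  then have "infinite (sphere (0::complex) 1 - (\<lambda>x. x / of_real (norm x)) ` E)"
    using finE by (intro Diff_infinite_finite) auto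
  then obtain u where u: "norm u = 1" "u \<notin> (\<lambda>x. x / of_real (norm x)) ` E"
    by (metis DiffE finite.emptyI infinite_imp_nonempty ex_in_conv mem_sphere_0)
  \<comment> \<open>The segment starts at modulus \<open>1 / 2\<close>, where the sequence is
    bounded by 1, and ends on the circle of radius \<open>s\<close>, so that its union with the
    circle is connected.\<close>
  define L where "L = (\<lambda>t::real. of_real t * u) ` {1/2..s}"
  define K where "K = sphere 0 s \<union> L"
  have contL: "continuous_on {1/2..s} (\<lambda>t::real. of_real t * u)" by (intro continuous_intros)
  have K: "compact K" unfolding K_def L_def
    by (intro compact_Un compact_continuous_image contL) auto
  have "of_real s * u \<in> sphere 0 s \<inter> L"
    using s u by (auto simp: L_def norm_mult)
  then have connK: "connected K" unfolding K_def
    by (intro connected_Un connected_sphere) (auto simp: L_def intro!: connected_continuous_image contL)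
  have "K \<inter> E = {}"
  proof -
    have notL: False if "t \<in> {1/2..s}" "of_real t * u \<in> E" for t :: real
    proof -
      have "u = (of_real t * u) / of_real (norm (of_real t * u))"
        using that(1) u(1) by (auto simp: norm_mult)
      then show False using u(2) that(2) by blast
    qed
    have "x \<notin> E" if "x \<in> L" for x using that notL unfolding L_def by blast
    moreover have "x \<notin> E" if "x \<in> sphere 0 s" for x using that s(3) by auto
    ultimately show ?thesis unfolding K_def by blast
  qed
  then obtain d where d: "d > 0" "\<And>x y. x \<in> K \<Longrightarrow> y \<in> E \<Longrightarrow> d \<le> dist x y"
    using separate_compact_closed[OF K finite_imp_closed[OF finE]] by blast
  have "1/2 * u \<in> L" unfolding L_def using s by (auto intro!: image_eqI[of _ _ "1/2"])
  obtain \<psi> x v \<sigma> H k where \<psi>: "strict_mono \<psi>" and x: "k \<in> K" "dist k x \<le> d / 2"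
    and v: "v \<longlonglongrightarrow> x" and H: "rescaled_limit (g \<circ> \<phi> \<circ> \<psi>) v \<sigma> H"
  proof (rule rescaled_limit_of_escape[where g = "g \<circ> \<phi>" and K = K and ?z0.0 = "1/2 * u" and ?B0.0 = 1 and \<eta> = "d / 2"])
    show "1/2 * u \<in> K" using \<open>1/2 * u \<in> L\<close> by (simp add: K_def)
    show "norm ((g \<circ> \<phi>) n (1/2 * u)) \<le> 1" for n
      using le1[of "1/2 * u" "\<phi> n"] u(1) by (simp add: norm_mult)
    fix B
    have "\<forall>\<^sub>F n in sequentially. \<exists>z\<in>cball 0 s. norm (g (\<phi> n) z) > B"
      by (rule eventually_subseq[OF \<phi> esc[OF s(1)]])
    then show "\<forall>\<^sub>F n in sequentially. \<exists>z\<in>K. norm ((g \<circ> \<phi>) n z) > B"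
    proof eventually_elim
      case (elim n)
      then obtain z where "z \<in> cball 0 s" "norm (g (\<phi> n) z) > B" by blast
      then have "\<exists>y\<in>sphere 0 s. norm (g (\<phi> n) y) > B"
        using s(1) by (intro maximum_modulus_sphere[OF hol]) auto
      then show ?case unfolding K_def by auto
    qed
  qed (use hol K connK d in auto)
  \<comment> \<open>Points of \<open>E\<close> have distance at least \<open>d\<close> from
    \<open>K\<close>, but \<open>x\<close> at most \<open>d / 2\<close>, so the new place is
    distinct from the earlier ones.\<close>
  have "x \<notin> E" using d x by fastforce
  define e' where "e' = e(M := x)"
  define w' where "w' = (\<lambda>i. if i < M then w i \<circ> \<psi> else v)"
  define \<tau>' where "\<tau>' = (\<lambda>i. if i < M then \<tau> i \<circ> \<psi> else \<sigma>)"
  define G' where "G' = G(M := H)"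
  have "inj_on e' {..<Suc M}"
    using inj \<open>x \<notin> E\<close> unfolding e'_def E_def lessThan_Suc by (auto simp: inj_on_def)
  moreover have "w' i \<longlonglongrightarrow> e' i \<and> rescaled_limit (g \<circ> (\<phi> \<circ> \<psi>)) (w' i) (\<tau>' i) (G' i)" if "i < Suc M" for i
  proof (cases "i < M")
    case True
    then show ?thesis
      using LIMSEQ_subseq_LIMSEQ[OF lim(1)[OF True] \<psi>] rescaled_limit_subseq[OF lim(2)[OF True] \<psi>]
      by (simp add: e'_def w'_def \<tau>'_def G'_def o_assoc)
  next
    case False
    then have "i = M" using that by simp
    then show ?thesis using v H by (simp add: e'_def w'_def \<tau>'_def G'_def o_assoc)
  qed
  moreover have "strict_mono (\<phi> \<circ> \<psi>)" using \<phi> \<psi> by (rule strict_mono_o)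
  ultimately show ?case by blast
qed

text \<open>The radius is the supremum of those whose closed disc satisfies the bound
  \<open>L\<close>. It is positive by continuity at 0, and finite because \<open>f\<close> exceeds
  \<open>L\<close> somewhere on every large circle.\<close>

lemma max_radius_exists:
  assumes f: "transcendental_entire f" and L: "norm (f 0) < L"
  shows "\<exists>r>0. (\<forall>z\<in>ball 0 r. norm (f z) \<le> L) \<and> (\<forall>s>r. \<exists>z\<in>cball 0 s. norm (f z) > L)"
proof -
  define S where "S = {r. 0 \<le> r \<and> (\<forall>z\<in>cball 0 r. norm (f z) \<le> L)}"
  have "continuous_on UNIV f"
    using f by (simp add: transcendental_entire_def holomorphic_on_imp_continuous_on)
  then have "open ((\<lambda>z. norm (f z)) -` {..<L})"
    by (intro open_vimage continuous_intros) auto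
  moreover have "0 \<in> (\<lambda>z. norm (f z)) -` {..<L}" using L by simp
  ultimately obtain d where d: "d > 0" "cball 0 d \<subseteq> (\<lambda>z. norm (f z)) -` {..<L}"
    by (meson open_contains_cball)
  then have dS: "d \<in> S" unfolding S_def by (auto simp: less_imp_le)
  obtain R where R: "\<And>r. r \<ge> R \<Longrightarrow> \<exists>z\<in>sphere 0 r. norm (f z) > L"
    using transcendental_entire_growth[OF f, of L 0] by (auto simp: eventually_at_top_linorder)
  have bdd: "bdd_above S"
  proof (rule bdd_aboveI)
    fix r assume "r \<in> S"
    then show "r \<le> R" using R[of r] by (force simp: S_def)
  qed
  define r where "r = Sup S"
  have "r > 0" using cSup_upper[OF dS bdd] d(1) by (simp add: r_def)
  moreover have "norm (f z) \<le> L" if "z \<in> ball 0 r" for z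
  proof -
    have "norm z < Sup S" using that by (simp add: r_def)
    then obtain t where "t \<in> S" "norm z < t"
      by (rule less_cSupE) (use dS in auto)
    then show ?thesis by (auto simp: S_def)
  qed
  moreover have "\<exists>z\<in>cball 0 s. norm (f z) > L" if "s > r" for s
  proof (rule ccontr)
    assume "\<not> ?thesis"
    then have "s \<in> S" using that \<open>r > 0\<close> by (auto simp: S_def not_less)
    then show False using cSup_upper[OF _ bdd] that by (force simp: r_def)
  qed
  ultimately show ?thesis by blast
qed

text \<open>With \<open>r n\<close> the radius at which the maximum modulus of \<open>f\<close>
  reaches \<open>norm (\<Lambda> n)\<close>, the functions \<open>f (r n * z) / \<Lambda> n\<close>
  are bounded by 1 on the unit disc but unbounded on every larger disc. As \<open>r n\<close> is
  negligible against \<open>norm (\<Lambda> n)\<close>, all places found at scale \<open>r n\<close>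
  merge into 0 at scale \<open>\<Lambda> n\<close>.\<close>

lemma rescaled_limits_at_origin:
  assumes f: "transcendental_entire f"
    and \<Lambda>: "filterlim \<Lambda> at_infinity sequentially" "\<And>n. norm (\<Lambda> n) > norm (f 0)"
  obtains r \<phi> e w \<tau> G where "strict_mono (\<phi> :: nat \<Rightarrow> nat)" "inj_on e {..<M::nat}"
    "\<And>n. r n > 0" "(\<lambda>n. r n / norm (\<Lambda> n)) \<longlonglongrightarrow> 0"
    "\<And>i. i < M \<Longrightarrow> w i \<longlonglongrightarrow> e i"
    "\<And>i. i < M \<Longrightarrow> rescaled_limit (\<lambda>n z. f (of_real (r (\<phi> n)) * z) / \<Lambda> (\<phi> n)) (w i) (\<tau> i) (G i)"
proof -
  have hol: "f holomorphic_on UNIV"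
    using f by (simp add: transcendental_entire_def)
  obtain r where r: "\<And>n. r n > 0" "\<And>n z. z \<in> ball 0 (r n) \<Longrightarrow> norm (f z) \<le> norm (\<Lambda> n)"
      "\<And>n s. s > r n \<Longrightarrow> \<exists>z\<in>cball 0 s. norm (f z) > norm (\<Lambda> n)"
    using max_radius_exists[OF f \<Lambda>(2)] by metis
  have \<Lambda>0: "norm (\<Lambda> n) > 0" for n using \<Lambda>(2)[of n] norm_ge_zero[of "f 0"] by linarith
  have \<Lambda>top: "filterlim (\<lambda>n. norm (\<Lambda> n)) at_top sequentially"
    using \<Lambda>(1) by (rule filterlim_norm_at_top[THEN filterlim_compose])
  have "filterlim r at_top sequentially"
    unfolding filterlim_at_top_dense
  proof
    fix R :: real
    have "compact (f ` cball 0 (\<bar>R\<bar> + 1))"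
      by (intro compact_continuous_image compact_cball)
         (meson hol continuous_on_subset holomorphic_on_imp_continuous_on subset_UNIV)
    then obtain b where b: "\<And>z. z \<in> cball 0 (\<bar>R\<bar> + 1) \<Longrightarrow> norm (f z) \<le> b"
      by (force dest!: compact_imp_bounded simp: bounded_iff)
    have "\<forall>\<^sub>F n in sequentially. norm (\<Lambda> n) > b"
      using \<Lambda>top by (simp add: filterlim_at_top_dense)
    then show "\<forall>\<^sub>F n in sequentially. R < r n"
    proof eventually_elim
      case (elim n)
      show ?case
      proof (rule ccontr)
        assume "\<not> R < r n"
        then have "r n < \<bar>R\<bar> + 1" by linarith
        then obtain z where "z \<in> cball 0 (\<bar>R\<bar> + 1)" "norm (f z) > norm (\<Lambda> n)"
          using r(3) by blast
        then show False using b elim by fastforce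
      qed
    qed
  qed
  then have half: "filterlim (\<lambda>n. r n / 2) at_top sequentially"
    using filterlim_tendsto_pos_mult_at_top[OF tendsto_const[of "1/2::real"], of r] by simp
  \<comment> \<open>On the circle of radius \<open>r n / 2\<close> the function \<open>f\<close> is
    bounded by \<open>norm (\<Lambda> n)\<close> and yet beats any multiple of
    \<open>(r n / 2) ^ k\<close>. Consequently every Taylor coefficient of \<open>g n\<close> at 0
    tends to 0.\<close>
  have pow: "(\<lambda>n. r n ^ k / norm (\<Lambda> n)) \<longlonglongrightarrow> 0" for k
  proof (rule tendstoI)
    fix \<epsilon> :: real assume "\<epsilon> > 0"
    have "\<forall>\<^sub>F n in sequentially. \<exists>z\<in>sphere 0 (r n / 2). norm (f z) > (2 ^ k / \<epsilon>) * (r n / 2) ^ k"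
      by (rule eventually_compose_filterlim[OF transcendental_entire_growth[OF f] half])
    then show "\<forall>\<^sub>F n in sequentially. dist (r n ^ k / norm (\<Lambda> n)) 0 < \<epsilon>"
    proof eventually_elim
      case (elim n)
      then obtain z where z: "norm z = r n / 2" "norm (f z) > (2 ^ k / \<epsilon>) * (r n / 2) ^ k" by auto
      have "norm (f z) \<le> norm (\<Lambda> n)"
        using z(1) r(1)[of n] by (intro r(2)) simp
      moreover have "(2 ^ k / \<epsilon>) * (r n / 2) ^ k = r n ^ k / \<epsilon>"
        by (simp add: power_divide)
      ultimately have "r n ^ k / \<epsilon> < norm (\<Lambda> n)" using z(2) by linarith
      then show ?case
        using r(1)[of n] \<Lambda>0[of n] \<open>\<epsilon> > 0\<close> by (simp add: abs_divide field_simps)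
    qed
  qed
  define g where "g = (\<lambda>n z. f (of_real (r n) * z) / \<Lambda> n)"
  have holg: "g n holomorphic_on A" for n A
    unfolding g_def divide_inverse using holomorphic_affine_comp[OF hol, of 0 "of_real (r n)" A]
    by (intro holomorphic_intros) simp
  have derg: "(deriv ^^ k) (g n) 0 = of_real (r n) ^ k * (deriv ^^ k) f 0 / \<Lambda> n" for k n
  proof -
    have "(deriv ^^ k) (\<lambda>z. inverse (\<Lambda> n) * f (of_real (r n) * z)) 0
        = inverse (\<Lambda> n) * (deriv ^^ k) (\<lambda>z. f (of_real (r n) * z)) 0"
      using holomorphic_affine_comp[OF hol, of 0 "of_real (r n)" UNIV]
      by (subst higher_deriv_cmult[where A = UNIV]) auto
    also have "(deriv ^^ k) (\<lambda>z. f (of_real (r n) * z)) 0 = of_real (r n) ^ k * (deriv ^^ k) f (of_real (r n) * 0)"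
      by (rule higher_deriv_compose_linear[OF hol open_UNIV open_UNIV]) auto
    finally show ?thesis by (simp add: g_def divide_inverse mult_ac)
  qed
  have le1: "norm (g n z) \<le> 1" if "z \<in> ball 0 1" for n z
  proof -
    have "norm (f (of_real (r n) * z)) \<le> norm (\<Lambda> n)"
      using that r(1)[of n] by (intro r(2)) (simp add: norm_mult)
    then show ?thesis using \<Lambda>0[of n] by (simp add: g_def norm_divide)
  qed
  \<comment> \<open>A subsequence bounded on the disc of radius \<open>s\<close> would have a Montel
    limit with all derivatives 0 at the origin, hence the limit 0, contradicting values of modulus
    above 1 just outside the unit disc.\<close>
  have esc: "\<forall>\<^sub>F n in sequentially. \<exists>z\<in>cball 0 s. norm (g n z) > B" if "s > 1" for s B
  proof (rule ccontr)
    assume neg: "\<not> ?thesis"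
    then have "\<forall>N. \<exists>n\<ge>N. \<forall>z\<in>cball 0 s. norm (g n z) \<le> B"
      by (auto simp: eventually_sequentially not_less)
    then have "infinite {n. \<forall>z\<in>cball 0 s. norm (g n z) \<le> B}"
      unfolding infinite_nat_iff_unbounded_le by blast
    then obtain \<psi> :: "nat \<Rightarrow> nat" where \<psi>: "strict_mono \<psi>" "\<And>n z. z \<in> cball 0 s \<Longrightarrow> norm (g (\<psi> n) z) \<le> B"
      using infinite_enumerate by blast
    obtain G \<psi>' where G: "G holomorphic_on ball 0 s" and \<psi>': "strict_mono (\<psi>' :: nat \<Rightarrow> nat)"
      and ulim: "\<And>K. compact K \<Longrightarrow> K \<subseteq> ball 0 s \<Longrightarrow> uniform_limit K ((\<lambda>n. g (\<psi> n)) \<circ> \<psi>') G sequentially"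
    proof (rule Montel[of "ball 0 s" "range (\<lambda>n. g (\<psi> n))" "\<lambda>n. g (\<psi> n)"])
      show "\<exists>B. \<forall>h\<in>range (\<lambda>n. g (\<psi> n)). \<forall>z\<in>K. norm (h z) \<le> B" if "K \<subseteq> ball 0 s" for K
        using \<psi>(2) that by (intro exI[of _ B]) (force simp: subset_eq)
    qed (auto intro: holg)
    \<comment> \<open>A radius strictly between 1 and \<open>s\<close>: large enough to contain a
      point with \<open>norm (g m z) > 1\<close>, small enough for uniform convergence.\<close>
    define s' where "s' = (1 + s) / 2"
    have s': "1 < s'" "s' < s" using \<open>s > 1\<close> by (auto simp: s'_def)
    have u: "uniform_limit (cball 0 s') (\<lambda>n. g (\<psi> (\<psi>' n))) G sequentially"
    proof -
      have "cball (0::complex) s' \<subseteq> ball 0 s" using s' by auto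
      from ulim[OF compact_cball this] show ?thesis by (simp add: o_def)
    qed
    have \<psi>\<psi>: "strict_mono (\<psi> \<circ> \<psi>')" using \<psi>(1) \<psi>' by (rule strict_mono_o)
    have "(deriv ^^ k) G 0 = 0" for k
    proof (rule LIMSEQ_unique)
      show "(\<lambda>n. (deriv ^^ k) (g (\<psi> (\<psi>' n))) 0) \<longlonglongrightarrow> (deriv ^^ k) G 0"
        by (rule higher_deriv_complex_uniform_limit[where A = "ball 0 1"])
           (use s' in \<open>auto intro: uniform_limit_on_subset[OF u] holg always_eventually\<close>)
      have "(\<lambda>n. norm ((deriv ^^ k) f 0) * (r n ^ k / norm (\<Lambda> n))) \<longlonglongrightarrow> norm ((deriv ^^ k) f 0) * 0"
        by (intro tendsto_intros pow)
      moreover have "norm ((deriv ^^ k) f 0) * (r n ^ k / norm (\<Lambda> n)) = norm ((deriv ^^ k) (g n) 0)" for n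
        using r(1)[of n] by (simp add: derg norm_mult norm_divide norm_power)
      ultimately have "(\<lambda>n. (deriv ^^ k) (g n) 0) \<longlonglongrightarrow> 0"
        by (simp add: tendsto_norm_zero_iff)
      then show "(\<lambda>n. (deriv ^^ k) (g (\<psi> (\<psi>' n))) 0) \<longlonglongrightarrow> 0"
        using LIMSEQ_subseq_LIMSEQ[OF _ \<psi>\<psi>] by (fastforce simp: o_def)
    qed
    then have G0: "G z = 0" if "z \<in> ball 0 s" for z
      using holomorphic_fun_eq_0_on_ball[OF G that] by blast
    have "\<forall>\<^sub>F n in sequentially. \<forall>z\<in>cball 0 s'. dist (g (\<psi> (\<psi>' n)) z) (G z) < 1"
      using u unfolding uniform_limit_iff by (meson zero_less_one)
    then obtain n where n: "\<And>z. z \<in> cball 0 s' \<Longrightarrow> dist (g (\<psi> (\<psi>' n)) z) (G z) < 1"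
      using eventually_happens'[OF sequentially_bot] by blast
    define m where "m = \<psi> (\<psi>' n)"
    have "r m < r m * s'" using s' r(1)[of m] by simp
    then obtain y where y: "norm y \<le> r m * s'" "norm (f y) > norm (\<Lambda> m)"
      using r(3)[of m] by fastforce
    define z where "z = y / of_real (r m)"
    have z: "z \<in> cball 0 s'" "of_real (r m) * z = y"
      using y(1) r(1)[of m] by (auto simp: z_def norm_divide divide_le_eq mult.commute)
    moreover have "norm (g m z) > 1"
      using z(2) y(2) \<Lambda>0[of m] by (simp add: g_def norm_divide)
    moreover have "G z = 0" using z(1) s' by (intro G0) auto
    ultimately show False using n[of z] by (simp add: m_def)
  qed
  obtain \<phi> e w \<tau> G where *: "strict_mono \<phi>" "inj_on e {..<M}"
      "\<forall>i<M. w i \<longlonglongrightarrow> e i \<and> rescaled_limit (g \<circ> \<phi>) (w i) (\<tau> i) (G i)"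
    using many_rescaled_limits[OF holg le1 esc, of M] by blast
  show ?thesis
    by (rule that[of \<phi> e r w \<tau> G]) (use * r(1) pow[of 1] in \<open>auto simp: g_def o_def\<close>)
qed

section \<open>Periodic patterns of islands\<close>

text \<open>This is Hurwitz's theorem in quantitative form: a solution of
  \<open>G \<zeta> = v\<close> is isolated, and on a small circle around it \<open>G - v\<close>
  dominates the error of approximation by \<open>g n\<close>.\<close>

lemma rescaled_limit_disc:
  assumes hol: "\<And>n. g n holomorphic_on UNIV" and lim: "rescaled_limit g w \<tau> G" and v: "G \<zeta> = v"
  shows "\<exists>R>0. \<exists>\<eta>>0. \<forall>\<^sub>F n in sequentially.
    (\<forall>x\<in>sphere (w n + of_real (\<tau> n) * \<zeta>) (\<tau> n * R). norm (g n x - v) > \<eta>) \<and>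
    (\<exists>x\<in>ball (w n + of_real (\<tau> n) * \<zeta>) (\<tau> n * R). g n x = v)"
proof -
  have G: "G holomorphic_on UNIV" "\<not> G constant_on UNIV" and \<tau>: "\<And>n. \<tau> n > 0"
    and ulim: "\<And>K. compact K \<Longrightarrow> uniform_limit K (\<lambda>n \<zeta>. g n (w n + of_real (\<tau> n) * \<zeta>)) G sequentially"
    using lim by (auto simp: rescaled_limit_def)
  define H where "H = (\<lambda>n y. g n (w n + of_real (\<tau> n) * y))"
  have holH: "H n holomorphic_on A" for n A
    unfolding H_def by (rule holomorphic_affine_comp[OF hol])
  have holG: "(\<lambda>y. G y - v) holomorphic_on A" for A
    using holomorphic_on_subset[OF G(1), of A] by (intro holomorphic_intros) auto
  obtain \<beta> where "G \<beta> - v \<noteq> 0"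
    using G(2) unfolding constant_on_def by force
  then obtain r where r: "r > 0" "\<And>y. y \<in> ball \<zeta> r - {\<zeta>} \<Longrightarrow> G y - v \<noteq> 0"
    using isolated_zeros[OF holG[of UNIV], of \<zeta> \<beta>] v by auto
  define R where "R = r / 2"
  have R: "R > 0" "cball \<zeta> R \<subseteq> ball \<zeta> r" using r(1) by (auto simp: R_def)
  have nz: "norm (G y - v) > 0" if "y \<in> sphere \<zeta> R" for y
  proof -
    have "y \<in> ball \<zeta> r - {\<zeta>}" using that R by auto
    then show ?thesis using r(2) by simp
  qed
  have "continuous_on (sphere \<zeta> R) (\<lambda>y. norm (G y - v))"
    by (intro continuous_on_norm holomorphic_on_imp_continuous_on holG)
  then obtain y0 where y0: "y0 \<in> sphere \<zeta> R" "\<And>y. y \<in> sphere \<zeta> R \<Longrightarrow> norm (G y0 - v) \<le> norm (G y - v)"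
    using continuous_attains_inf[of "sphere \<zeta> R" "\<lambda>y. norm (G y - v)"] R(1) by auto
  \<comment> \<open>Half of the minimum over the circle; the other half absorbs the approximation
    error.\<close>
  define \<eta> where "\<eta> = norm (G y0 - v) / 2"
  have \<eta>: "\<eta> > 0" using nz[OF y0(1)] by (simp add: \<eta>_def)
  have far: "norm (G y - v) \<ge> 2 * \<eta>" if "y \<in> sphere \<zeta> R" for y
    using y0(2)[OF that] by (simp add: \<eta>_def)
  have "\<forall>\<^sub>F n in sequentially. \<forall>y\<in>cball \<zeta> R. dist (H n y) (G y) < \<eta>"
    using ulim[of "cball \<zeta> R"] \<eta> unfolding uniform_limit_iff H_def by auto
  then have "\<forall>\<^sub>F n in sequentially.
    (\<forall>x\<in>sphere (w n + of_real (\<tau> n) * \<zeta>) (\<tau> n * R). norm (g n x - v) > \<eta>) \<and>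
    (\<exists>x\<in>ball (w n + of_real (\<tau> n) * \<zeta>) (\<tau> n * R). g n x = v)"
  proof eventually_elim
    case (elim n)
    have near: "norm (H n y - G y) < \<eta>" if "y \<in> cball \<zeta> R" for y
      using elim that by (auto simp: dist_norm)
    have "norm (g n x - v) > \<eta>" if x: "x \<in> sphere (w n + of_real (\<tau> n) * \<zeta>) (\<tau> n * R)" for x
    proof -
      define y where "y = (x - w n) / of_real (\<tau> n)"
      have xy: "x = w n + of_real (\<tau> n) * y" using \<tau>[of n] by (simp add: y_def)
      have "norm (of_real (\<tau> n) * (\<zeta> - y)) = \<tau> n * R"
        using x by (simp add: xy dist_norm algebra_simps)
      then have y: "y \<in> sphere \<zeta> R"
        using \<tau>[of n] by (simp add: norm_mult dist_norm)
      then have "norm (H n y - G y) < \<eta>" by (intro near) auto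
      moreover have "norm (G y - v) \<le> norm (H n y - v) + norm (H n y - G y)"
        using norm_triangle_ineq4[of "H n y - v" "H n y - G y"] by simp
      ultimately have "norm (H n y - v) > \<eta>" using far[OF y] by linarith
      then show ?thesis by (simp add: H_def xy)
    qed
    moreover have "\<exists>y\<in>ball \<zeta> R. (G y - v) + (H n y - G y) = 0"
    proof (rule zero_of_dominated_perturbation[where h = "\<lambda>y. G y - v" and p = "\<lambda>y. H n y - G y" and V = "ball \<zeta> R"])
      have "(\<lambda>y. H n y - G y) holomorphic_on A" for A
        using holH[of n A] holomorphic_on_subset[OF G(1), of A] by (intro holomorphic_intros) auto
      note holD = this
      show "(\<lambda>y. H n y - G y) holomorphic_on ball \<zeta> R" by (rule holD)
      show "continuous_on (closure (ball \<zeta> R)) (\<lambda>y. H n y - G y)"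
        by (rule holomorphic_on_imp_continuous_on[OF holD])
      show "continuous_on (closure (ball \<zeta> R)) (\<lambda>y. G y - v)"
        by (rule holomorphic_on_imp_continuous_on[OF holG])
      fix y assume "y \<in> frontier (ball \<zeta> R)"
      then have y: "y \<in> sphere \<zeta> R" using R(1) by simp
      then have "norm (H n y - G y) < \<eta>" by (intro near) auto
      then show "norm (H n y - G y) < norm (G y - v)" using far[OF y] \<eta> by linarith
    qed (use R v holG in auto)
    then obtain y where y: "y \<in> ball \<zeta> R" "H n y = v" by auto
    have "norm (of_real (\<tau> n) * (\<zeta> - y)) < \<tau> n * R"
      using y(1) \<tau>[of n] by (simp add: norm_mult dist_norm)
    then have "w n + of_real (\<tau> n) * y \<in> ball (w n + of_real (\<tau> n) * \<zeta>) (\<tau> n * R)"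
      by (simp add: dist_norm algebra_simps)
    then have "\<exists>x\<in>ball (w n + of_real (\<tau> n) * \<zeta>) (\<tau> n * R). g n x = v"
      using y(2) by (auto simp: H_def)
    ultimately show ?case by blast
  qed
  then show ?thesis using R(1) \<eta> by blast
qed

text \<open>After division by \<open>\<Lambda> n\<close>, the discs shrink to \<open>a\<close> as \<open>n\<close> grows, whereas \<open>\<eta>\<close>, the radius of the disc
  around \<open>v\<close> that is covered, stays fixed.\<close>
definition has_islands ::
  "(complex \<Rightarrow> complex) \<Rightarrow> (nat \<Rightarrow> complex) \<Rightarrow> complex \<Rightarrow> complex \<Rightarrow> nat \<Rightarrow> bool" where
  "has_islands f \<Lambda> a v N \<longleftrightarrow> (\<exists>\<eta>>0. \<forall>\<rho>>0. \<forall>\<^sub>F n in sequentially. \<exists>q r.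
     (\<forall>s<N. r s > 0 \<and> cball (q s) (r s) \<subseteq> cball (\<Lambda> n * a) (\<rho> * norm (\<Lambda> n)) \<and>
        (\<forall>z\<in>sphere (q s) (r s). norm (f z - \<Lambda> n * v) > \<eta> * norm (\<Lambda> n)) \<and>
        (\<exists>z\<in>ball (q s) (r s). f z = \<Lambda> n * v)) \<and>
     (\<forall>s<N. \<forall>s'<N. s \<noteq> s' \<longrightarrow> cball (q s) (r s) \<inter> cball (q s') (r s') = {}))"

text \<open>Arguments are scaled by \<open>S n\<close> and values by \<open>\<Lambda> n\<close>, so
  \<open>\<kappa>\<close> compares the two scales. For \<open>S = \<Lambda>\<close> and
  \<open>\<kappa> = 1\<close> the islands lie near \<open>\<Lambda> n * e i\<close>; for
  \<open>\<kappa> = 0\<close> they all lie near 0 at scale \<open>\<Lambda> n\<close>, yet are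
  disjoint because the \<open>e i\<close> differ at scale \<open>S n\<close>.\<close>

lemma has_islands_of_rescaled_limits:
  assumes hol: "f holomorphic_on UNIV"
    and nz: "\<And>n. S n \<noteq> 0" "\<And>n. \<Lambda> n \<noteq> (0::complex)"
    and \<kappa>: "(\<lambda>n. S n / \<Lambda> n) \<longlonglongrightarrow> \<kappa>" "\<And>i. i < N \<Longrightarrow> \<kappa> * e i = a"
    and inj: "inj_on e {..<N}"
    and w: "\<And>i. i < N \<Longrightarrow> w i \<longlonglongrightarrow> e i"
    and lim: "\<And>i. i < N \<Longrightarrow> rescaled_limit (\<lambda>n z. f (S n * z) / \<Lambda> n) (w i) (\<tau> i) (G i)"
    and v: "\<And>i. i < N \<Longrightarrow> v \<in> range (G i)"
  shows "has_islands f \<Lambda> a v N"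
proof -
  define g where "g = (\<lambda>n z. f (S n * z) / \<Lambda> n)"
  have holg: "g n holomorphic_on UNIV" for n
  proof -
    have "(\<lambda>z. f (S n * z)) holomorphic_on UNIV"
      using holomorphic_affine_comp[OF hol, of 0 "S n" UNIV] by simp
    then show ?thesis
      unfolding g_def divide_inverse by (rule holomorphic_on_mult[OF _ holomorphic_on_const])
  qed
  have "\<forall>i\<in>{..<N}. \<exists>x. G i x = v"
    using v by (fastforce simp: image_iff)
  then obtain \<zeta> where "\<forall>i\<in>{..<N}. G i (\<zeta> i) = v"
    by (rule bchoice[THEN exE])
  then have \<zeta>: "G i (\<zeta> i) = v" if "i < N" for i using that by auto
  define c where "c = (\<lambda>i n. w i n + of_real (\<tau> i n) * \<zeta> i)"
  define J where "J = (\<lambda>i R \<eta>. \<forall>\<^sub>F n in sequentially.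
      (\<forall>x\<in>sphere (c i n) (\<tau> i n * R). norm (g n x - v) > \<eta>) \<and> (\<exists>x\<in>ball (c i n) (\<tau> i n * R). g n x = v))"
  have "\<exists>R>0. \<exists>\<eta>>0. J i R \<eta>" if "i < N" for i
    unfolding c_def J_def using rescaled_limit_disc[OF holg lim[OF that, folded g_def] \<zeta>[OF that]] .
  then obtain R \<eta> where R: "\<And>i. i < N \<Longrightarrow> R i > 0" "\<And>i. i < N \<Longrightarrow> \<eta> i > 0"
      and ev: "\<And>i. i < N \<Longrightarrow> J i (R i) (\<eta> i)"
    by metis
  define b where "b = (\<lambda>i n. \<tau> i n * R i)"
  have \<tau>: "\<tau> i n > 0" "\<tau> i \<longlonglongrightarrow> 0" if "i < N" for i n
    using lim[OF that] by (auto simp: rescaled_limit_def)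
  have b: "b i n > 0" "b i \<longlonglongrightarrow> 0" if "i < N" for i n
  proof -
    show "b i n > 0" using \<tau>(1) R(1) that by (simp add: b_def)
    have "(\<lambda>n. \<tau> i n * R i) \<longlonglongrightarrow> 0 * R i" by (intro tendsto_intros \<tau> that)
    then show "b i \<longlonglongrightarrow> 0" by (simp add: b_def)
  qed
  have c: "c i \<longlonglongrightarrow> e i" if "i < N" for i
  proof -
    have "c i \<longlonglongrightarrow> e i + of_real 0 * \<zeta> i"
      unfolding c_def by (intro tendsto_intros w \<tau> that)
    then show ?thesis by simp
  qed
  \<comment> \<open>Inserting 1 keeps the minimum meaningful for \<open>N = 0\<close>.\<close>
  define \<eta>0 where "\<eta>0 = Min (insert 1 (\<eta> ` {..<N}))"
  have \<eta>0: "\<eta>0 > 0"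
    unfolding \<eta>0_def using R(2) by (subst Min_gr_iff) auto
  have \<eta>0_le: "\<eta>0 \<le> \<eta> i" if "i < N" for i
    unfolding \<eta>0_def using that by (intro Min_le) auto
  have ev1: "\<forall>\<^sub>F n in sequentially. \<forall>i\<in>{..<N}.
      (\<forall>x\<in>sphere (c i n) (b i n). norm (g n x - v) > \<eta> i) \<and> (\<exists>x\<in>ball (c i n) (b i n). g n x = v)"
    using ev unfolding b_def J_def by (intro eventually_ball_finite) auto
  have ev2: "\<forall>\<^sub>F n in sequentially. \<forall>i\<in>{..<N}. \<forall>j\<in>{..<N}. i \<noteq> j \<longrightarrow> b i n + b j n < dist (c i n) (c j n)"
  proof (intro eventually_ball_finite ballI)
    fix i j assume ij: "i \<in> {..<N}" "j \<in> {..<N}"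
    show "\<forall>\<^sub>F n in sequentially. i \<noteq> j \<longrightarrow> b i n + b j n < dist (c i n) (c j n)"
    proof (cases "i = j")
      case False
      have "(\<lambda>n. dist (c i n) (c j n) - (b i n + b j n)) \<longlonglongrightarrow> dist (e i) (e j) - (0 + 0)"
        using ij by (intro tendsto_intros b c) auto
      moreover have "dist (e i) (e j) - (0 + 0) > 0"
        using False ij inj by (auto simp: inj_on_def)
      ultimately have "\<forall>\<^sub>F n in sequentially. dist (c i n) (c j n) - (b i n + b j n) > 0"
        by (rule order_tendstoD)
      then show ?thesis by (rule eventually_mono) simp
    qed simp
  qed auto
  have "\<forall>\<^sub>F n in sequentially. \<exists>q r.
     (\<forall>s<N. r s > 0 \<and> cball (q s) (r s) \<subseteq> cball (\<Lambda> n * a) (\<rho> * norm (\<Lambda> n)) \<and>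
        (\<forall>z\<in>sphere (q s) (r s). norm (f z - \<Lambda> n * v) > \<eta>0 * norm (\<Lambda> n)) \<and>
        (\<exists>z\<in>ball (q s) (r s). f z = \<Lambda> n * v)) \<and>
     (\<forall>s<N. \<forall>s'<N. s \<noteq> s' \<longrightarrow> cball (q s) (r s) \<inter> cball (q s') (r s') = {})"
    if \<rho>: "\<rho> > 0" for \<rho>
  proof -
    have "\<forall>\<^sub>F n in sequentially. \<forall>i\<in>{..<N}. norm (S n / \<Lambda> n * c i n - a) + norm (S n / \<Lambda> n) * b i n < \<rho>"
    proof (intro eventually_ball_finite ballI)
      fix i assume i: "i \<in> {..<N}"
      have "(\<lambda>n. norm (S n / \<Lambda> n * c i n - a) + norm (S n / \<Lambda> n) * b i n) \<longlonglongrightarrow>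
          norm (\<kappa> * e i - a) + norm \<kappa> * 0"
        using i by (intro tendsto_intros \<kappa>(1) b c) auto
      moreover have "norm (\<kappa> * e i - a) + norm \<kappa> * 0 < \<rho>" using \<kappa>(2)[of i] i \<rho> by simp
      ultimately show "\<forall>\<^sub>F n in sequentially. norm (S n / \<Lambda> n * c i n - a) + norm (S n / \<Lambda> n) * b i n < \<rho>"
        by (rule order_tendstoD)
    qed auto
    with ev1 ev2 show ?thesis
    proof eventually_elim
      case (elim n)
      define q where "q = (\<lambda>s. S n * c s n)"
      define r where "r = (\<lambda>s. norm (S n) * b s n)"
      have dq: "dist (q s) (S n * x) = norm (S n) * dist (c s n) x" for s x
        by (simp add: q_def dist_norm flip: norm_mult right_diff_distrib)
      have Sp: "norm (S n) > 0" "norm (\<Lambda> n) > 0" using nz by auto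
      have fg: "f (S n * x) = \<Lambda> n * g n x" for x using nz(2) by (simp add: g_def)
      have inv: "z = S n * (z / S n)" for z using nz(1) by simp
      have "r s > 0 \<and> cball (q s) (r s) \<subseteq> cball (\<Lambda> n * a) (\<rho> * norm (\<Lambda> n)) \<and>
        (\<forall>z\<in>sphere (q s) (r s). norm (f z - \<Lambda> n * v) > \<eta>0 * norm (\<Lambda> n)) \<and>
        (\<exists>z\<in>ball (q s) (r s). f z = \<Lambda> n * v)" if s: "s < N" for s
      proof (intro conjI ballI subsetI)
        show "r s > 0" using b(1)[OF s] Sp by (simp add: r_def)
        show "z \<in> cball (\<Lambda> n * a) (\<rho> * norm (\<Lambda> n))" if "z \<in> cball (q s) (r s)" for z
        proof -
          have "norm (S n / \<Lambda> n * c s n - a) + norm (S n / \<Lambda> n) * b s n \<le> \<rho>"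
            using elim(3) s by (auto intro: less_imp_le)
          then have "norm (\<Lambda> n) * (norm (S n / \<Lambda> n * c s n - a) + norm (S n / \<Lambda> n) * b s n) \<le> norm (\<Lambda> n) * \<rho>"
            using Sp by (intro mult_left_mono) auto
          moreover have "norm (\<Lambda> n) * norm (S n / \<Lambda> n * c s n - a) = norm (q s - \<Lambda> n * a)"
            using nz(2)[of n] by (simp add: q_def algebra_simps flip: norm_mult)
          moreover have "norm (\<Lambda> n) * (norm (S n / \<Lambda> n) * b s n) = r s"
            using Sp by (simp add: r_def norm_divide)
          ultimately have "norm (q s - \<Lambda> n * a) + r s \<le> \<rho> * norm (\<Lambda> n)"
            by (simp add: algebra_simps)
          moreover have "dist (\<Lambda> n * a) z \<le> dist (q s) (\<Lambda> n * a) + dist (q s) z"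
            by (rule dist_triangle3)
          ultimately show ?thesis using that by (simp add: dist_norm)
        qed
        show "norm (f z - \<Lambda> n * v) > \<eta>0 * norm (\<Lambda> n)" if "z \<in> sphere (q s) (r s)" for z
        proof -
          have "dist (q s) z = norm (S n) * dist (c s n) (z / S n)"
            using dq[of s "z / S n"] by (simp only: inv[of z, symmetric])
          then have "norm (S n) * dist (c s n) (z / S n) = norm (S n) * b s n"
            using that by (simp only: mem_sphere r_def)
          then have "z / S n \<in> sphere (c s n) (b s n)" using Sp by simp
          then have "norm (g n (z / S n) - v) > \<eta> s" using elim(1) s by auto
          then have "norm (g n (z / S n) - v) > \<eta>0" using \<eta>0_le[OF s] by linarith
          moreover have "f z - \<Lambda> n * v = \<Lambda> n * (g n (z / S n) - v)"
            using fg[of "z / S n"] inv[of z] by (simp add: algebra_simps)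
          ultimately show ?thesis using Sp by (simp add: norm_mult mult.commute)
        qed
        obtain x where x: "x \<in> ball (c s n) (b s n)" "g n x = v"
          using elim(1) s by (meson lessThan_iff)
        have "S n * x \<in> ball (q s) (r s)" using x(1) Sp by (simp add: dq r_def)
        then show "\<exists>z\<in>ball (q s) (r s). f z = \<Lambda> n * v"
          using x(2) fg by (intro bexI[of _ "S n * x"]) auto
      qed
      moreover have "cball (q s) (r s) \<inter> cball (q s') (r s') = {}" if ss: "s < N" "s' < N" "s \<noteq> s'" for s s'
      proof (rule disjoint_cballI)
        have "b s n + b s' n < dist (c s n) (c s' n)" using elim(2) ss by auto
        then have "norm (S n) * (b s n + b s' n) < norm (S n) * dist (c s n) (c s' n)" using Sp by simp
        then show "dist (q s) (q s') > r s + r s'"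
          using dq[of s "c s' n"] by (simp add: q_def r_def algebra_simps)
      qed
      ultimately show ?case by blast
    qed
  qed
  then show ?thesis unfolding has_islands_def using \<eta>0 by blast
qed

text \<open>A period has finitely many positions, so a single large \<open>n\<close> provides the
  islands at all of them; the pattern multiplied by \<open>\<Lambda> n\<close> is then a horseshoe
  with \<open>N\<close> choices at the positions divisible by \<open>P\<close>.\<close>

lemma htop_henon_ge_of_islands:
  fixes a :: "nat \<Rightarrow> complex"
  assumes f: "f holomorphic_on UNIV" and \<Lambda>: "\<And>n. \<Lambda> n \<noteq> 0" and pos: "P > 0" "N > 0"
    and per: "\<And>k. a (k + P) = a k"
    and isl: "\<And>k. k < P \<Longrightarrow>
      has_islands f \<Lambda> (a (Suc k)) (a (Suc (Suc k)) + \<delta> * a k) (if k = 0 then N else 1)"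
  shows "htop UNIV (henon_map f \<delta>) \<ge> ereal (ln (real N) / real P)"
proof -
  define V where "V = (\<lambda>k. a (Suc (Suc k)) + \<delta> * a k)"
  define c where "c = (\<lambda>k::nat. if k = 0 then N else 1)"
  define I where "I = (\<lambda>\<eta> \<rho> n k q r.
     (\<forall>s<c k. (r s :: real) > 0 \<and> cball (q s) (r s) \<subseteq> cball (\<Lambda> n * a (Suc k)) (\<rho> * norm (\<Lambda> n)) \<and>
        (\<forall>z\<in>sphere (q s) (r s). norm (f z - \<Lambda> n * V k) > \<eta> * norm (\<Lambda> n)) \<and>
        (\<exists>z\<in>ball (q s) (r s). f z = \<Lambda> n * V k)) \<and>
     (\<forall>s<c k. \<forall>s'<c k. s \<noteq> s' \<longrightarrow> cball (q s) (r s) \<inter> cball (q s') (r s') = {}))"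
  define J where "J = (\<lambda>k \<eta>. \<forall>\<rho>>0. \<forall>\<^sub>F n in sequentially. \<exists>q r. I \<eta> \<rho> n k q r)"
  have "\<exists>\<eta>>0. J k \<eta>" if "k < P" for k
    using isl[OF that] unfolding has_islands_def J_def I_def V_def c_def .
  then have "\<forall>k\<in>{..<P}. \<exists>\<eta>. \<eta> > 0 \<and> J k \<eta>" by blast
  then obtain \<eta> where "\<forall>k\<in>{..<P}. \<eta> k > 0 \<and> J k (\<eta> k)"
    by (rule bchoice[THEN exE])
  then have \<eta>: "\<And>k. k < P \<Longrightarrow> \<eta> k > 0" "\<And>k. k < P \<Longrightarrow> J k (\<eta> k)"
    by auto
  define \<eta>0 where "\<eta>0 = Min (\<eta> ` {..<P})"
  have \<eta>0: "\<eta>0 > 0"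
    unfolding \<eta>0_def using \<eta>(1) pos by (subst Min_gr_iff) auto
  have \<eta>0_le: "\<eta>0 \<le> \<eta> k" if "k < P" for k
    unfolding \<eta>0_def using that by (intro Min_le) auto
  \<comment> \<open>The error \<open>(1 + norm \<delta>) * \<rho>\<close> of following the pattern
    only approximately becomes exactly the guaranteed covering radius \<open>\<eta>0\<close>. This
    is possible because \<open>\<eta>0\<close> was fixed before \<open>\<rho>\<close>.\<close>
  define \<rho> where "\<rho> = \<eta>0 / (1 + norm \<delta>)"
  have nd: "1 + norm \<delta> > 0" by (simp add: add_pos_nonneg)
  have \<rho>: "\<rho> > 0" "(1 + norm \<delta>) * \<rho> = \<eta>0"
    using \<eta>0 nd by (auto simp: \<rho>_def)
  have "\<forall>\<^sub>F n in sequentially. \<forall>k\<in>{..<P}. \<exists>q r. I (\<eta> k) \<rho> n k q r"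
    using \<eta>(2) \<rho>(1) unfolding J_def by (intro eventually_ball_finite) auto
  then obtain n where "\<forall>k\<in>{..<P}. \<exists>q r. I (\<eta> k) \<rho> n k q r"
    using eventually_happens'[OF sequentially_bot] by blast
  then obtain q where "\<forall>k\<in>{..<P}. \<exists>r. I (\<eta> k) \<rho> n k (q k) r"
    by (rule bchoice[THEN exE])
  then obtain r where "\<forall>k\<in>{..<P}. I (\<eta> k) \<rho> n k (q k) (r k)"
    by (rule bchoice[THEN exE])
  then have qr: "\<And>k. k < P \<Longrightarrow> I (\<eta> k) \<rho> n k (q k) (r k)"
    by blast
  have \<Lambda>p: "norm (\<Lambda> n) > 0" using \<Lambda> by simp
  have per': "a (k + m * P) = a k" for k m
    by (induction m) (use per[of "k + _ * P"] in \<open>auto simp: algebra_simps\<close>)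
  have am: "a k = a (k mod P)" "a (Suc k) = a (Suc (k mod P))" "a (Suc (Suc k)) = a (Suc (Suc (k mod P)))" for k
    using per'[of "k mod P" "k div P"] per'[of "Suc (k mod P)" "k div P"] per'[of "Suc (Suc (k mod P))" "k div P"]
    by simp_all
  have kP: "k mod P < P" for k using pos by simp
  \<comment> \<open>A genuine choice among islands exists only at multiples of \<open>P\<close>;
    elsewhere the single island has index 0.\<close>
  define t where "t = (\<lambda>k s::nat. if k mod P = 0 then s else 0)"
  have tc: "t k s < c (k mod P)" if "s < N" for k s
    using that by (simp add: t_def c_def)
  have disj: "cball (q 0 s) (r 0 s) \<inter> cball (q 0 s') (r 0 s') = {}" if "s < N" "s' < N" "s \<noteq> s'" for s s'
    using qr[of 0] pos that unfolding I_def c_def by auto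
  have "\<exists>d>0. \<forall>x\<in>cball (q 0 s) (r 0 s). \<forall>y\<in>cball (q 0 s') (r 0 s'). d \<le> dist x y"
    if "s < N" "s' < N" "s \<noteq> s'" for s s'
    by (rule separate_compact_closed[OF compact_cball closed_cball disj[OF that]])
  then obtain d where d: "\<And>s s'. s < N \<Longrightarrow> s' < N \<Longrightarrow> s \<noteq> s' \<Longrightarrow> d s s' > 0 \<and>
      (\<forall>x\<in>cball (q 0 s) (r 0 s). \<forall>y\<in>cball (q 0 s') (r 0 s'). d s s' \<le> dist x y)"
    by metis
  \<comment> \<open>The element 1 keeps the set nonempty when \<open>N = 1\<close>. Half of its
    minimum is taken below since separation asks for a strict inequality.\<close>
  define D where "D = insert 1 {d s s' |s s'. s < N \<and> s' < N \<and> s \<noteq> s'}"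
  have "D \<subseteq> insert 1 ((\<lambda>(s, s'). d s s') ` ({..<N} \<times> {..<N}))"
    by (auto simp: D_def)
  then have finD: "finite D" by (rule finite_subset) auto
  define \<epsilon> where "\<epsilon> = Min D / 2"
  have "Min D > 0"
    using d finD by (subst Min_gr_iff) (auto simp: D_def)
  have \<epsilon>: "\<epsilon> > 0" using \<open>Min D > 0\<close> by (simp add: \<epsilon>_def)
  have \<epsilon>d: "\<epsilon> < d s s'" if "s < N" "s' < N" "s \<noteq> s'" for s s'
  proof -
    have "Min D \<le> d s s'" by (rule Min_le[OF finD]) (use that in \<open>auto simp: D_def\<close>)
    then show ?thesis using \<open>Min D > 0\<close> by (simp add: \<epsilon>_def)
  qed
  show ?thesis
  proof (rule htop_henon_ge_of_horseshoe[where f = f and \<delta> = \<delta> and P = P and N = N and \<epsilon> = \<epsilon>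
        and \<rho> = "\<rho> * norm (\<Lambda> n)" and a = "\<lambda>k. \<Lambda> n * a k" and M = "\<Sum>j<P. norm (\<Lambda> n * a j)"
        and q = "\<lambda>k s. q (k mod P) (t k s)" and r = "\<lambda>k s. r (k mod P) (t k s)"])
    show "norm (\<Lambda> n * a k) \<le> (\<Sum>j<P. norm (\<Lambda> n * a j))" for k
      unfolding am(1)[of k] by (rule member_le_sum) (use kP in auto)
    fix k s assume s: "s < N"
    have Q: "r (k mod P) (t k s) > 0"
       "cball (q (k mod P) (t k s)) (r (k mod P) (t k s)) \<subseteq> cball (\<Lambda> n * a (Suc (k mod P))) (\<rho> * norm (\<Lambda> n))"
       "\<And>z. z \<in> sphere (q (k mod P) (t k s)) (r (k mod P) (t k s)) \<Longrightarrow>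
          norm (f z - \<Lambda> n * V (k mod P)) > \<eta> (k mod P) * norm (\<Lambda> n)"
       "\<exists>z\<in>ball (q (k mod P) (t k s)) (r (k mod P) (t k s)). f z = \<Lambda> n * V (k mod P)"
      using qr[OF kP[of k]] tc[OF s, of k] unfolding I_def by auto
    have V: "\<Lambda> n * a (Suc (Suc k)) + \<delta> * (\<Lambda> n * a k) = \<Lambda> n * V (k mod P)"
      unfolding V_def am[of k] by (simp add: algebra_simps)
    show "r (k mod P) (t k s) > 0" by (rule Q)
    show "cball (q (k mod P) (t k s)) (r (k mod P) (t k s)) \<subseteq> cball (\<Lambda> n * a (Suc k)) (\<rho> * norm (\<Lambda> n))"
      using Q(2) by (simp only: am(2)[of k])
    show "\<exists>z\<in>ball (q (k mod P) (t k s)) (r (k mod P) (t k s)).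
        f z = \<Lambda> n * a (Suc (Suc k)) + \<delta> * (\<Lambda> n * a k)"
      unfolding V by (rule Q)
    fix z assume "z \<in> sphere (q (k mod P) (t k s)) (r (k mod P) (t k s))"
    then have "\<eta> (k mod P) * norm (\<Lambda> n) < norm (f z - \<Lambda> n * V (k mod P))" by (rule Q)
    moreover have "\<eta>0 * norm (\<Lambda> n) \<le> \<eta> (k mod P) * norm (\<Lambda> n)"
      using \<eta>0_le[OF kP] by (simp add: mult_right_mono)
    moreover have "(1 + norm \<delta>) * (\<rho> * norm (\<Lambda> n)) = \<eta>0 * norm (\<Lambda> n)"
      unfolding \<rho>(2)[symmetric] by (simp only: mult.assoc)
    ultimately show "(1 + norm \<delta>) * (\<rho> * norm (\<Lambda> n)) < norm (f z - (\<Lambda> n * a (Suc (Suc k)) + \<delta> * (\<Lambda> n * a k)))"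
      unfolding V by linarith
  next
    fix j s s' z z'
    assume s: "s < N" "s' < N" "s \<noteq> s'"
      and z: "z \<in> cball (q (j * P mod P) (t (j * P) s)) (r (j * P mod P) (t (j * P) s))"
        "z' \<in> cball (q (j * P mod P) (t (j * P) s')) (r (j * P mod P) (t (j * P) s'))"
    have "d s s' \<le> dist z z'"
      using d[OF s] z by (simp add: t_def del: mem_cball)
    then show "dist z z' > \<epsilon>" using \<epsilon>d[OF s] by linarith
  qed (use f pos \<epsilon> \<rho> in auto)
qed

section \<open>Omitted values and the choice of the pattern\<close>

lemma range_rescaled_limit:
  assumes "rescaled_limit g w \<tau> G" "a \<notin> range G" "b \<noteq> a"
  shows "b \<in> range G"
proof (rule ccontr)
  assume "b \<notin> range G"
  then have "range G \<inter> {a, b} = {}" using assms by auto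
  then obtain c where "G = (\<lambda>x. c)"
    using little_Picard[of G a b] assms by (auto simp: rescaled_limit_def)
  then show False using assms by (auto simp: rescaled_limit_def constant_on_def)
qed

text \<open>Only the value 0 can cause trouble, because a limit omitting it takes every other value.
  The pattern is chosen so that \<open>a (Suc (Suc k)) + \<delta> * a k\<close> is 0 only at places
  whose limits take 0.\<close>

lemma htop_henon_ge:
  assumes f: "transcendental_entire f" and \<delta>: "\<delta> \<noteq> 0" and N: "N > 0"
  shows "htop UNIV (henon_map f \<delta>) \<ge> ereal (ln (real N) / 4)"
proof -
  have hol: "f holomorphic_on UNIV" using f by (simp add: transcendental_entire_def)
  have lnN: "ln (real N) \<ge> 0" using N by simp
  obtain \<Lambda> e w \<tau> H where \<Lambda>: "\<And>n. norm (\<Lambda> n) \<ge> (norm (f 0) + 1) + real n" and e: "e \<noteq> 0" "w \<longlonglongrightarrow> e"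
    and H: "rescaled_limit (\<lambda>n z. f (\<Lambda> n * z) / \<Lambda> n) w \<tau> H"
    by (rule rescaled_limit_off_origin[OF f, where C = "norm (f 0) + 1"]) (rule that; assumption)
  have \<Lambda>n: "real n \<le> norm (\<Lambda> n)" for n
    using \<Lambda>[of n] norm_ge_zero[of "f 0"] by linarith
  have "filterlim (\<lambda>n. norm (\<Lambda> n)) at_top sequentially"
    by (rule filterlim_at_top_mono[OF filterlim_real_sequentially])
       (rule always_eventually, rule allI, rule \<Lambda>n)
  then have "filterlim \<Lambda> at_infinity sequentially" by (rule filterlim_at_infinity_conv_norm_at_top[THEN iffD2])
  moreover have "norm (\<Lambda> n) > norm (f 0)" for n using \<Lambda>[of n] by linarith
  ultimately obtain r \<phi> e' w' \<tau>' G where \<phi>: "strict_mono \<phi>" and inj: "inj_on e' {..<2 * N}"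
    and r: "\<And>n. r n > 0" "(\<lambda>n. r n / norm (\<Lambda> n)) \<longlonglongrightarrow> 0"
    and w': "\<And>i. i < 2 * N \<Longrightarrow> w' i \<longlonglongrightarrow> e' i"
    and G: "\<And>i. i < 2 * N \<Longrightarrow>
      rescaled_limit (\<lambda>n z. f (of_real (r (\<phi> n)) * z) / \<Lambda> (\<phi> n)) (w' i) (\<tau>' i) (G i)"
    by (rule rescaled_limits_at_origin[OF f, where M = "2 * N"]) (rule that; assumption)
  \<comment> \<open>Islands at \<open>e\<close> and at 0 must share their multipliers, so the limit
    \<open>H\<close> is restricted to the subsequence found for the origin.\<close>
  define L where "L = \<Lambda> \<circ> \<phi>"
  have L0: "L n \<noteq> 0" for n
  proof -
    have "norm (L n) > 0" unfolding L_def o_def by (rule less_le_trans[OF _ \<Lambda>]) (simp add: add_nonneg_pos add_pos_nonneg)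
    then show ?thesis by simp
  qed
  have at_e: "has_islands f L e v 1" if "v \<in> range H" for v
  proof (rule has_islands_of_rescaled_limits[where S = L and \<kappa> = 1 and e = "\<lambda>_. e"])
    show "(w \<circ> \<phi>) \<longlonglongrightarrow> e" by (rule LIMSEQ_subseq_LIMSEQ[OF e(2) \<phi>])
    show "rescaled_limit (\<lambda>n z. f (L n * z) / L n) (w \<circ> \<phi>) (\<tau> \<circ> \<phi>) H"
      using rescaled_limit_subseq[OF H \<phi>] by (simp add: L_def o_def)
  qed (use hol L0 that in \<open>auto simp: inj_on_def\<close>)
  have rL: "(\<lambda>n. of_real (r (\<phi> n)) / L n) \<longlonglongrightarrow> 0"
  proof (rule tendsto_norm_zero_cancel)
    have "(\<lambda>n. norm (of_real (r (\<phi> n)) / L n)) = (\<lambda>n. r n / norm (\<Lambda> n)) \<circ> \<phi>"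
      using r(1) by (auto simp: L_def norm_divide less_imp_le)
    then show "(\<lambda>n. norm (of_real (r (\<phi> n)) / L n)) \<longlonglongrightarrow> 0"
      using LIMSEQ_subseq_LIMSEQ[OF r(2) \<phi>] by simp
  qed
  have at_0: "has_islands f L 0 v m"
    if B: "B \<subseteq> {..<2 * N}" "m \<le> card B" "\<And>i. i \<in> B \<Longrightarrow> v \<in> range (G i)" for B v m
  proof -
    have "finite B" using B(1) finite_subset by blast
    then obtain h where h: "bij_betw h {..<card B} B"
      using ex_bij_betw_nat_finite[of B] by (auto simp: atLeast0LessThan)
    have hB: "h i \<in> B" "h i < 2 * N" if "i < m" for i
      using that B(1,2) bij_betw_apply[OF h, of i] by auto
    show ?thesis
    proof (rule has_islands_of_rescaled_limits[where S = "\<lambda>n. of_real (r (\<phi> n))" and \<kappa> = 0 and e = "\<lambda>i. e' (h i)"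
          and w = "\<lambda>i. w' (h i)" and \<tau> = "\<lambda>i. \<tau>' (h i)" and G = "\<lambda>i. G (h i)"])
      show "inj_on (\<lambda>i. e' (h i)) {..<m}"
      proof (rule inj_onI)
        fix i j assume ij: "i \<in> {..<m}" "j \<in> {..<m}" "e' (h i) = e' (h j)"
        then have "h i = h j" using hB inj by (auto simp: inj_on_def)
        then show "i = j" using bij_betw_imp_inj_on[OF h] ij B(2) by (auto simp: inj_on_def)
      qed
      show "rescaled_limit (\<lambda>n z. f (of_real (r (\<phi> n)) * z) / L n) (w' (h i)) (\<tau>' (h i)) (G (h i))" if "i < m" for i
        using G[OF hB(2)[OF that]] by (simp add: L_def)
      show "of_real (r (\<phi> n)) \<noteq> (0::complex)" for n using r(1)[of "\<phi> n"] by simp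
    qed (use hol L0 rL w' hB B(3) in auto)
  qed
  \<comment> \<open>Of the \<open>2 * N\<close> limits at the origin, either \<open>N\<close> take
    the value 0, or at least \<open>N\<close> omit it and thus take all nonzero values.\<close>
  define B where "B = {i. i < 2 * N \<and> 0 \<in> range (G i)}"
  show ?thesis
  proof (cases "N \<le> card B")
    case True
    have "has_islands f L 0 0 N"
      by (rule at_0[where B = B]) (use True in \<open>auto simp: B_def\<close>)
    then have "htop UNIV (henon_map f \<delta>) \<ge> ereal (ln (real N) / real 1)"
      by (intro htop_henon_ge_of_islands[where \<Lambda> = L and a = "\<lambda>_. 0"] hol L0 N) auto
    moreover have "ln (real N) / 4 \<le> ln (real N) / real 1" using lnN by simp
    ultimately show ?thesis by (meson ereal_less_eq(3) order_trans)
  next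
    case False
    define B' where "B' = {..<2 * N} - B"
    have "card B' = 2 * N - card B"
      unfolding B'_def by (subst card_Diff_subset) (auto simp: B_def)
    then have card: "N \<le> card B'" "1 \<le> card B'" using False N by auto
    have omit: "v \<in> range (G i)" if "i \<in> B'" "v \<noteq> 0" for i v
      using that by (intro range_rescaled_limit[OF G, where a = 0]) (auto simp: B'_def B_def)
    have near0: "has_islands f L 0 v m" if "v \<noteq> 0" "m \<le> N" for v m
      by (rule at_0[where B = B']) (use that card omit in \<open>auto simp: B'_def\<close>)
    have \<delta>e: "\<delta> * e \<noteq> 0" using \<delta> e by simp
    show ?thesis
    proof (cases "0 \<in> range H")
      case True
      \<comment> \<open>The values required at the two places 0 are \<open>\<delta> * e\<close> and
        \<open>e\<close>, both nonzero; at \<open>e\<close> the required value is 0, which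
        \<open>H\<close> takes.\<close>
      define a where "a = (\<lambda>k::nat. if k mod 3 = 0 then e else 0)"
      have "htop UNIV (henon_map f \<delta>) \<ge> ereal (ln (real N) / real 3)"
      proof (rule htop_henon_ge_of_islands[where \<Lambda> = L and a = a])
        fix k :: nat assume "k < 3"
        then consider "k = 0" | "k = 1" | "k = 2" by linarith
        then show "has_islands f L (a (Suc k)) (a (Suc (Suc k)) + \<delta> * a k) (if k = 0 then N else 1)"
          by cases (use near0 e(1) \<delta>e N at_e[OF True] in \<open>simp_all add: a_def\<close>)
      qed (use hol L0 N in \<open>auto simp: a_def\<close>)
      moreover have "ln (real N) / 4 \<le> ln (real N) / real 3" using lnN by simp
      ultimately show ?thesis by (meson ereal_less_eq(3) order_trans)
    next
      case False
      have nearE: "has_islands f L e v 1" if "v \<noteq> 0" for v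
        by (rule at_e[OF range_rescaled_limit[OF H False that]])
      \<comment> \<open>If \<open>H\<close> omits 0, the doubled \<open>e\<close> helps: the
        required values are \<open>\<delta> * e\<close> and \<open>e\<close> at the places 0, then
        \<open>e\<close> and \<open>\<delta> * e\<close> at the places \<open>e\<close>, none of
        them 0.\<close>
      define a where "a = (\<lambda>k::nat. if k mod 4 = 0 \<or> k mod 4 = 3 then e else 0)"
      have "htop UNIV (henon_map f \<delta>) \<ge> ereal (ln (real N) / real 4)"
      proof (rule htop_henon_ge_of_islands[where \<Lambda> = L and a = a])
        fix k :: nat assume "k < 4"
        then consider "k = 0" | "k = 1" | "k = 2" | "k = 3" by linarith
        then show "has_islands f L (a (Suc k)) (a (Suc (Suc k)) + \<delta> * a k) (if k = 0 then N else 1)"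
          by cases (use near0 nearE e(1) \<delta>e N in \<open>simp_all add: a_def\<close>)
      qed (use hol L0 N in \<open>auto simp: a_def\<close>)
      then show ?thesis by simp
    qed
  qed
qed

theorem theorem1:
  fixes f :: "complex \<Rightarrow> complex" and \<delta> :: complex
  assumes "transcendental_entire f" and "\<delta> \<noteq> 0"
  shows "htop (UNIV :: (complex \<times> complex) set) (henon_map f \<delta>) = \<infinity>"
proof (rule ereal_top)
  fix B :: real
  obtain N :: nat where N: "exp (4 * B) \<le> real N" using real_arch_simple by blast
  have "real N > 0" using less_le_trans[OF exp_gt_zero N] .
  then have "4 * B \<le> ln (real N)" using N by (simp add: ln_ge_iff)
  then have "ereal B \<le> ereal (ln (real N) / 4)" by simp
  also have "\<dots> \<le> htop UNIV (henon_map f \<delta>)"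
    by (rule htop_henon_ge[OF assms]) (use \<open>real N > 0\<close> in simp)
  finally show "ereal B \<le> htop UNIV (henon_map f \<delta>)" .
qed

end
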